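(* For every $\alpha>0$, $$\frac{1}{n^{1-\frac{\alpha}{2}}}\left(MST_n-\mathbb{E}MST_n\right)\longrightarrow 0\quad\text{almost surely as } n\to\infty.$$
   Context: $S$ is the unit square in $\mathbb{R}^2$ and $d(x,y)$ is the Euclidean distance. $f$ is a probability density on $S$ with $\epsilon_1 \leq \inf_{x\in S} f(x) \leq \sup_{x \in S} f(x) \leq \epsilon_2$ for constants $0<\epsilon_1\leq\epsilon_2<\infty$; $X_1,X_2,\ldots$ are i.i.d. with density $f$ on a common probability space. $h:S\times S\to[0,\infty)$ is a deterministic measurable function with $c_1 d(x,y)\leq h(x,y)=h(y,x)\leq c_2 d(x,y)$ for all $x,y\in S$, for some positive constants $c_1,c_2$. $K_n$ is the complete graph on the nodes $X_1,\ldots,X_n$, the edge $(X_i,X_j)$ having weight $(h(X_i,X_j))^{\alpha}$. $MST_n$ is the minimum, over all spanning trees of $K_n$, of the sum of the weights of the edges of the tree. *)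

theory Defs
  imports "HOL-Probability.Probability"
begin

definition unit_square :: "(real^2) set" where
  "unit_square = cbox 0 1"

text \<open>
  An undirected simple graph is given by a vertex set and a set of edges, each edge being a
  two-element set of vertices. (In the directed setting of Graph_Theory, a symmetric pair of
  arcs already is a cycle, so the trees defined there are not the undirected ones.)
\<close>

definition complete_edges :: "'v set \<Rightarrow> 'v set set" where
  "complete_edges V = {{u, v} | u v. u \<in> V \<and> v \<in> V \<and> u \<noteq> v}"

definition graph_connected :: "'v set \<Rightarrow> 'v set set \<Rightarrow> bool" where
  "graph_connected V E \<longleftrightarrow> (\<forall>u\<in>V. \<forall>v\<in>V. (u, v) \<in> {(x, y). {x, y} \<in> E}\<^sup>*)"

definition graph_cycle :: "'v set set \<Rightarrow> 'v list \<Rightarrow> bool" where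
  "graph_cycle E vs \<longleftrightarrow>
     3 \<le> length vs \<and> distinct vs \<and>
     (\<forall>i<length vs. {vs ! i, vs ! (Suc i mod length vs)} \<in> E)"

definition spanning_tree :: "'v set \<Rightarrow> 'v set set \<Rightarrow> 'v set set \<Rightarrow> bool" where
  "spanning_tree V E T \<longleftrightarrow> T \<subseteq> E \<and> graph_connected V T \<and> (\<nexists>vs. graph_cycle T vs)"

text \<open>
  The node \<open>x i\<close> is represented by its index \<open>i\<close>, so that nodes stay distinct even if
  their positions coincide. An edge \<open>{i, j}\<close> is read off as \<open>(Min e, Max e)\<close>; as \<open>h\<close> is
  assumed symmetric on the square, the orientation is immaterial.
  For \<open>n \<ge> 1\<close> the outer \<open>Min\<close> ranges over a finite nonempty set.
\<close>

definition edge_weight ::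
  "(real^2 \<Rightarrow> real^2 \<Rightarrow> real) \<Rightarrow> real \<Rightarrow> (nat \<Rightarrow> real^2) \<Rightarrow> nat set \<Rightarrow> real" where
  "edge_weight h \<alpha> x e = h (x (Min e)) (x (Max e)) powr \<alpha>"

definition MST ::
  "(real^2 \<Rightarrow> real^2 \<Rightarrow> real) \<Rightarrow> real \<Rightarrow> (nat \<Rightarrow> real^2) \<Rightarrow> nat \<Rightarrow> real" where
  "MST h \<alpha> x n =
     Min {\<Sum>e\<in>T. edge_weight h \<alpha> x e | T. spanning_tree {1..n} (complete_edges {1..n}) T}"

end

theory Submission
  imports Defs "HOL-Real_Asymp.Real_Asymp"
begin

text \<open>
  The idea is to replace \<open>MST\<close> by a functional that moves only a little when a single point moves,
  to apply the bounded differences inequality to it, and to show that the replacement changes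
  nothing outside an event of tiny probability.

  \<^bold>\<open>The functional.\<close> Cut the weights off at a level \<open>r\<close>: use \<open>min (h x y) r\<close> instead of \<open>h x y\<close>.
  Adding a point then costs at most \<open>r powr \<alpha>\<close>. Removing a point \<open>p\<close> is the delicate direction,
  because as soon as \<open>c\<^sub>1 < c\<^sub>2\<close> the degree of \<open>p\<close> in a minimal tree need not be bounded. In a minimal
  tree whose degree at \<open>p\<close> is least, however, two neighbours \<open>y\<close>, \<open>z\<close> of \<open>p\<close> satisfy
  \<open>h y z > max (h p y) (h p z)\<close>, for otherwise an edge at \<open>p\<close> could be exchanged for \<open>{y, z}\<close>. Thus the
  neighbours in each dyadic shell around \<open>p\<close> are separated on the scale of that shell, so that
  their number is bounded; joining all neighbours to the one nearest to \<open>p\<close> costs a geometric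
  series, which is of order \<open>r powr \<alpha>\<close> (\<open>removal_cost\<close>). So moving one point changes the functional by
  \<open>O(r powr \<alpha>)\<close>, for every configuration of points (\<open>truncated_MST_bounded_differences\<close>).

  \<^bold>\<open>The exceptional event.\<close> Divide the square into \<open>m \<times> m\<close> cells. If every cell contains a point, then
  by connectedness of the square any division of the points into two classes leaves two points at
  distance at most \<open>4 / m\<close> on different sides, so that edges of weight above \<open>r = 4 * c\<^sub>2 / m\<close> can be
  exchanged for shorter ones, and the truncation does not change the minimum
  (\<open>MST_truncated_eq_outside\<close>). As the density is at least \<open>\<epsilon>\<close>, some cell is empty with
  probability at most \<open>m\<^sup>2 * exp (- \<epsilon> * n / m\<^sup>2)\<close>.

  \<^bold>\<open>The choice of scales.\<close> Take \<open>m\<close> of order \<open>n powr (1/2 - s)\<close> with \<open>s > 0\<close> and \<open>s * \<alpha> \<le> 1/4\<close>. Then the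
  exceptional event has probability at most \<open>n * exp (- \<epsilon> * n powr (2 * s))\<close>, and the differences are
  \<open>O(n powr (1/4 - \<alpha>/2))\<close>. The bounded differences inequality (\<open>bounded_differences_tail\<close>) bounds the
  probability of a deviation of \<open>n powr (7/8 - \<alpha>/2)\<close> by \<open>2 * exp (- c * n powr (1/4))\<close>. Both bounds are
  summable, the Borel--Cantelli lemma applies, and \<open>n powr (7/8 - \<alpha>/2)\<close> is of smaller order than
  \<open>n powr (1 - \<alpha>/2)\<close>.
\<close>

section \<open>Minimal connected edge sets\<close>

abbreviation adj :: "'v set set \<Rightarrow> ('v \<times> 'v) set" where
  "adj E \<equiv> {(x, y). {x, y} \<in> E}"

lemma adj_rtrancl_sym: "(u, v) \<in> (adj E)\<^sup>* \<Longrightarrow> (v, u) \<in> (adj E)\<^sup>*"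
proof -
  have "sym (adj E)" by (auto simp: sym_def insert_commute)
  then show "(u, v) \<in> (adj E)\<^sup>* \<Longrightarrow> (v, u) \<in> (adj E)\<^sup>*"
    by (meson sym_rtrancl symD)
qed

text \<open>
  What justifies deleting or exchanging an edge: the lost edge is replaced by a path.
\<close>
lemma graph_connected_transfer:
  assumes "graph_connected V T" "\<And>a b. {a, b} \<in> T \<Longrightarrow> (a, b) \<in> (adj T')\<^sup>*"
  shows "graph_connected V T'"
proof -
  have "adj T \<subseteq> (adj T')\<^sup>*" using assms(2) by auto
  then have "(adj T)\<^sup>* \<subseteq> (adj T')\<^sup>*" by (rule rtrancl_subset_rtrancl)
  then show ?thesis using assms(1) unfolding graph_connected_def by blast
qed

lemma graph_connected_Diff_edge:
  assumes "graph_connected V T" "(a, b) \<in> (adj (T - {{a, b}}))\<^sup>*"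
  shows "graph_connected V (T - {{a, b}})"
proof (rule graph_connected_transfer[OF assms(1)])
  fix c d assume cd: "{c, d} \<in> T"
  show "(c, d) \<in> (adj (T - {{a, b}}))\<^sup>*"
  proof (cases "{c, d} = {a, b}")
    case True
    then have "c = a \<and> d = b \<or> c = b \<and> d = a" by (simp add: doubleton_eq_iff)
    then show ?thesis using assms(2) adj_rtrancl_sym by fast
  next
    case False
    then have "(c, d) \<in> adj (T - {{a, b}})" using cd by simp
    then show ?thesis by (rule r_into_rtrancl)
  qed
qed

definition connected_edge_sets :: "'v set \<Rightarrow> 'v set set set" where
  "connected_edge_sets V = {T. T \<subseteq> complete_edges V \<and> graph_connected V T}"

text \<open>
  As weights are nonnegative, the cheapest connected edge set costs as much as the cheapest spanning
  tree (\<open>MST_eq_connection_cost\<close>). Minimising over connected edge sets lets edges be added and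
  exchanged without watching for cycles.
\<close>
definition connection_cost :: "('v set \<Rightarrow> real) \<Rightarrow> 'v set \<Rightarrow> real" where
  "connection_cost w V = Min (sum w ` connected_edge_sets V)"

lemma mem_complete_edges: "{u, v} \<in> complete_edges V \<longleftrightarrow> u \<in> V \<and> v \<in> V \<and> u \<noteq> v"
  by (auto simp: complete_edges_def doubleton_eq_iff)

lemma complete_edges_mono: "V \<subseteq> W \<Longrightarrow> complete_edges V \<subseteq> complete_edges W"
  by (auto simp: complete_edges_def)

lemma finite_complete_edges: "finite V \<Longrightarrow> finite (complete_edges V)"
  by (rule finite_subset[of _ "Pow V"]) (auto simp: complete_edges_def)

lemma complete_edges_connected: "complete_edges V \<in> connected_edge_sets V"
proof -
  have "(u, v) \<in> (adj (complete_edges V))\<^sup>*" if "u \<in> V" "v \<in> V" for u v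
    using that by (cases "u = v") (auto intro!: r_into_rtrancl simp: complete_edges_def)
  then show ?thesis by (auto simp: connected_edge_sets_def graph_connected_def)
qed

lemma finite_connected_edge_sets: "finite V \<Longrightarrow> finite (connected_edge_sets V)"
  by (rule finite_subset[of _ "Pow (complete_edges V)"])
     (auto simp: connected_edge_sets_def finite_complete_edges)

lemma finite_connected_edge_set: "finite V \<Longrightarrow> T \<in> connected_edge_sets V \<Longrightarrow> finite T"
  by (auto simp: connected_edge_sets_def intro: finite_subset finite_complete_edges)

lemma connection_cost_le:
  "finite V \<Longrightarrow> T \<in> connected_edge_sets V \<Longrightarrow> connection_cost w V \<le> sum w T"
  unfolding connection_cost_def by (intro Min_le) (auto simp: finite_connected_edge_sets)

text \<open>
  Exchange arguments often replace an edge by another one of the same weight, in particular when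
  weights are cut off. A secondary quantity \<open>\<mu>\<close>, minimised among the cheapest sets, makes such
  exchanges contradictory as well.
\<close>
lemma connection_cost_attained_minimal:
  fixes \<mu> :: "'v set set \<Rightarrow> nat"
  assumes "finite V"
  shows "\<exists>T\<in>connected_edge_sets V. sum w T = connection_cost w V \<and>
    (\<forall>T'\<in>connected_edge_sets V. sum w T' \<le> sum w T \<longrightarrow> \<mu> T \<le> \<mu> T')"
proof -
  define P where "P T \<longleftrightarrow> T \<in> connected_edge_sets V \<and> sum w T = connection_cost w V" for T
  have "connection_cost w V \<in> sum w ` connected_edge_sets V"
    unfolding connection_cost_def
    using assms complete_edges_connected by (intro Min_in) (auto simp: finite_connected_edge_sets)
  then obtain T0 where "P T0" by (auto simp: P_def)
  then obtain T where T: "P T" "\<And>T'. P T' \<Longrightarrow> \<mu> T \<le> \<mu> T'"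
    using ex_has_least_nat[of P T0 \<mu>] by blast
  have "\<mu> T \<le> \<mu> T'" if "T' \<in> connected_edge_sets V" "sum w T' \<le> sum w T" for T'
    using T that connection_cost_le[OF assms that(1), of w] by (auto simp: P_def)
  with T(1) show ?thesis by (auto simp: P_def)
qed

lemma connection_cost_attained:
  assumes "finite V"
  obtains T where "T \<in> connected_edge_sets V" "sum w T = connection_cost w V"
  using connection_cost_attained_minimal[OF assms, of w "\<lambda>_. 0"] by blast

lemma connection_cost_mono:
  assumes "finite V" "\<And>e. e \<in> complete_edges V \<Longrightarrow> w e \<le> w' e"
  shows "connection_cost w V \<le> connection_cost w' V"
proof -
  obtain T where T: "T \<in> connected_edge_sets V" "sum w' T = connection_cost w' V"
    using connection_cost_attained[OF assms(1), of w'] by blast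
  have "sum w T \<le> sum w' T"
    using T(1) assms(2) by (intro sum_mono) (auto simp: connected_edge_sets_def)
  with T connection_cost_le[OF assms(1) T(1), of w] show ?thesis by simp
qed

lemma connection_cost_cong:
  assumes "finite V" "\<And>e. e \<in> complete_edges V \<Longrightarrow> w e = w' e"
  shows "connection_cost w V = connection_cost w' V"
  by (intro antisym connection_cost_mono) (use assms in auto)

lemma connection_cost_nonneg:
  assumes "finite V" "\<And>e. e \<in> complete_edges V \<Longrightarrow> 0 \<le> w e"
  shows "0 \<le> connection_cost w V"
proof -
  obtain T where T: "T \<in> connected_edge_sets V" "sum w T = connection_cost w V"
    using connection_cost_attained[OF assms(1), of w] by blast
  have "0 \<le> sum w T"
    using T(1) assms(2) by (intro sum_nonneg) (auto simp: connected_edge_sets_def)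
  with T show ?thesis by simp
qed

text \<open>
  A connected subset of least cardinality has no cycle, since an edge of a cycle can be bypassed
  along the rest of the cycle.
\<close>
lemma connected_contains_spanning_tree:
  assumes "finite V" "T \<in> connected_edge_sets V"
  obtains T' where "T' \<subseteq> T" "spanning_tree V (complete_edges V) T'"
proof -
  define P where "P T' \<longleftrightarrow> T' \<subseteq> T \<and> graph_connected V T'" for T'
  have "P T" using assms by (auto simp: P_def connected_edge_sets_def)
  then obtain T' where T': "P T'" "\<And>T''. P T'' \<Longrightarrow> card T' \<le> card T''"
    using ex_has_least_nat[of P T card] by blast
  have fin: "finite T'" using T'(1) finite_connected_edge_set[OF assms]
    by (auto simp: P_def intro: finite_subset)
  have False if cyc: "graph_cycle T' vs" for vs
  proof -
    define k where "k = length vs - 1"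
    have len: "length vs = Suc k" "2 \<le> k" and dist: "distinct vs"
      and edges: "\<And>i. i < length vs \<Longrightarrow> {vs ! i, vs ! (Suc i mod length vs)} \<in> T'"
      using cyc by (auto simp: graph_cycle_def k_def)
    \<comment> \<open>The closing edge of the cycle; \<open>2 \<le> k\<close> keeps it distinct from the edges of the path.\<close>
    let ?e = "{vs ! 0, vs ! k}"
    have e: "?e \<in> T'" using edges[of k] len by (simp add: insert_commute)
    have "(vs ! 0, vs ! i) \<in> (adj (T' - {?e}))\<^sup>*" if "i \<le> k" for i
      using that
    proof (induction i)
      case (Suc i)
      have "{vs ! i, vs ! Suc i} \<in> T'" using edges[of i] len Suc.prems by simp
      moreover have "{vs ! i, vs ! Suc i} \<noteq> ?e"
        using dist len Suc.prems by (auto simp: doubleton_eq_iff nth_eq_iff_index_eq)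
      ultimately have "(vs ! i, vs ! Suc i) \<in> adj (T' - {?e})" by simp
      with Suc show ?case by (meson Suc_leD rtrancl.rtrancl_into_rtrancl)
    qed simp
    from this[of k] T'(1) have "P (T' - {?e})"
      using graph_connected_Diff_edge[of V T' "vs ! 0" "vs ! k"] by (auto simp: P_def)
    from T'(2)[OF this] card_Diff1_less[OF fin e] show False by simp
  qed
  then have "spanning_tree V (complete_edges V) T'"
    using T'(1) assms(2) by (auto simp: spanning_tree_def P_def connected_edge_sets_def)
  with T'(1) show ?thesis using that by (auto simp: P_def)
qed

lemma MST_eq_connection_cost: "MST h \<alpha> x n = connection_cost (edge_weight h \<alpha> x) {1..n}"
proof -
  let ?w = "edge_weight h \<alpha> x" and ?V = "{1..n}"
  let ?S = "{\<Sum>e\<in>T. ?w e | T. spanning_tree ?V (complete_edges ?V) T}"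
  have sub: "?S \<subseteq> sum ?w ` connected_edge_sets ?V"
    by (auto simp: spanning_tree_def connected_edge_sets_def)
  then have fin: "finite ?S" by (rule finite_subset) (simp add: finite_connected_edge_sets)
  obtain T where T: "T \<in> connected_edge_sets ?V" "sum ?w T = connection_cost ?w ?V"
    using connection_cost_attained[of ?V ?w] by auto
  obtain T' where T': "T' \<subseteq> T" "spanning_tree ?V (complete_edges ?V) T'"
    using connected_contains_spanning_tree[OF _ T(1)] by auto
  have "sum ?w T' \<le> sum ?w T"
    using T' finite_connected_edge_set[OF _ T(1)] by (intro sum_mono2) (auto simp: edge_weight_def)
  moreover have "Min ?S \<le> sum ?w T'" using T' fin by (intro Min_le) auto
  ultimately have "Min ?S \<le> connection_cost ?w ?V" using T by simp
  moreover have "connection_cost ?w ?V \<le> Min ?S"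
    unfolding connection_cost_def using sub T'(2)
    by (intro Min_antimono) (auto simp: finite_connected_edge_sets)
  ultimately show ?thesis by (simp add: MST_def)
qed

text \<open>
  Among the cheapest sets for the truncated weights, one with the fewest edges of weight above \<open>r\<close>
  has none: such an edge either can be dropped, or separates the vertices into two classes, and
  then an edge of weight at most \<open>r\<close> between the classes can take its place.
\<close>
lemma connection_cost_truncated:
  fixes w :: "'v set \<Rightarrow> real"
  assumes fin: "finite V"
    and cut: "\<And>A. A \<subseteq> V \<Longrightarrow> A \<noteq> {} \<Longrightarrow> A \<noteq> V \<Longrightarrow> \<exists>u\<in>A. \<exists>v\<in>V - A. w {u, v} \<le> r"
    and r: "0 \<le> r"
  shows "connection_cost (\<lambda>e. min (w e) r) V = connection_cost w V"
proof -
  let ?w = "\<lambda>e. min (w e) r"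
  obtain T where T: "T \<in> connected_edge_sets V" "sum ?w T = connection_cost ?w V"
    and fewest: "\<forall>T'\<in>connected_edge_sets V. sum ?w T' \<le> sum ?w T \<longrightarrow>
      card {e \<in> T. r < w e} \<le> card {e \<in> T'. r < w e}"
    using connection_cost_attained_minimal[OF fin, of ?w "\<lambda>T. card {e \<in> T. r < w e}"] by blast
  have finT: "finite T" using finite_connected_edge_set[OF fin T(1)] .
  have con: "graph_connected V T" and TV: "T \<subseteq> complete_edges V"
    using T(1) by (auto simp: connected_edge_sets_def)
  have short: "w e \<le> r" if eT: "e \<in> T" for e
  proof (rule ccontr)
    assume long: "\<not> w e \<le> r"
    from eT TV have "e \<in> complete_edges V" by blast
    then obtain a b where ab: "e = {a, b}" "a \<in> V" "b \<in> V" "a \<noteq> b"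
      unfolding complete_edges_def by blast
    let ?T = "T - {{a, b}}"
    define A where "A = {v \<in> V. (a, v) \<in> (adj ?T)\<^sup>*}"
    have "e \<in> {x \<in> T. r < w x}" "e \<notin> {x \<in> ?T. r < w x}" using eT ab(1) long by simp_all
    then have longer: "{x \<in> ?T. r < w x} \<subset> {x \<in> T. r < w x}" by blast
    have card_less: "card {x \<in> ?T. r < w x} < card {x \<in> T. r < w x}"
      by (rule psubset_card_mono[OF _ longer]) (use finT in simp)
    have sum_eq: "sum ?w T = sum ?w ?T + r"
      using eT long finT by (simp add: sum.remove[of T e] flip: ab(1))
    show False
    proof (cases "b \<in> A")
      case True
      then have "?T \<in> connected_edge_sets V"
        using graph_connected_Diff_edge[OF con, of a b] TV
        by (auto simp: A_def connected_edge_sets_def)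
      from fewest[rule_format, OF this] card_less sum_eq r show False by simp
    next
      case False
      have "a \<in> A" using ab by (simp add: A_def)
      then obtain u v where uv: "u \<in> A" "v \<in> V - A" "w {u, v} \<le> r"
        using cut[of A] False ab by (auto simp: A_def)
      \<comment> \<open>Without \<open>{a, b}\<close>, every vertex is still joined to \<open>a\<close> or to \<open>b\<close>.\<close>
      have "(a, c) \<in> (adj ?T)\<^sup>* \<or> (b, c) \<in> (adj ?T)\<^sup>*" if "(a, c) \<in> (adj T)\<^sup>*" for c
        using that
      proof induction
        case (step c d)
        show ?case
        proof (cases "{c, d} = {a, b}")
          case True
          then have "d = a \<or> d = b" by (auto simp: doubleton_eq_iff)
          then show ?thesis by auto
        next
          case False
          with step(2) have "(c, d) \<in> adj ?T" by simp
          with step.IH show ?thesis by (meson rtrancl.rtrancl_into_rtrancl)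
        qed
      qed auto
      moreover have "(a, v) \<in> (adj T)\<^sup>*" using con ab uv by (auto simp: graph_connected_def)
      ultimately have bv: "(b, v) \<in> (adj ?T)\<^sup>*" using uv by (auto simp: A_def)
      let ?T' = "insert {u, v} ?T"
      have mono: "(adj ?T)\<^sup>* \<subseteq> (adj ?T')\<^sup>*" by (intro rtrancl_mono) auto
      have "(a, u) \<in> (adj ?T')\<^sup>*" using uv mono by (auto simp: A_def)
      moreover have "(u, v) \<in> adj ?T'" by simp
      moreover have "(v, b) \<in> (adj ?T')\<^sup>*" using adj_rtrancl_sym[OF bv] mono by auto
      ultimately have path: "(a, b) \<in> (adj ?T')\<^sup>*" by (meson rtrancl.rtrancl_into_rtrancl rtrancl_trans)
      have "graph_connected V ?T'"
      proof (rule graph_connected_transfer[OF con])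
        fix c d assume cd: "{c, d} \<in> T"
        show "(c, d) \<in> (adj ?T')\<^sup>*"
        proof (cases "{c, d} = {a, b}")
          case True
          then have "c = a \<and> d = b \<or> c = b \<and> d = a" by (simp add: doubleton_eq_iff)
          then show ?thesis using path adj_rtrancl_sym by fast
        next
          case False
          then have "(c, d) \<in> adj ?T'" using cd by simp
          then show ?thesis by (rule r_into_rtrancl)
        qed
      qed
      moreover have "u \<in> V" using uv by (auto simp: A_def)
      moreover have "u \<noteq> v" using uv by auto
      ultimately have T': "?T' \<in> connected_edge_sets V"
        using TV uv by (auto simp: connected_edge_sets_def mem_complete_edges)
      have "sum ?w ?T' \<le> r + sum ?w ?T" if "{u, v} \<notin> ?T"
        using that finT uv(3) by (subst sum.insert) auto
      then have "sum ?w ?T' \<le> r + sum ?w ?T"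
        using r by (cases "{u, v} \<in> ?T") (simp_all only: insert_absorb, simp)
      then have "sum ?w ?T' \<le> sum ?w T" using sum_eq by simp
      from fewest[rule_format, OF T' this] have "card {x \<in> T. r < w x} \<le> card {x \<in> ?T'. r < w x}" .
      also have "{x \<in> ?T'. r < w x} = {x \<in> ?T. r < w x}" using uv(3) by auto
      finally show False using card_less by simp
    qed
  qed
  have "connection_cost w V \<le> sum w T" using connection_cost_le[OF fin T(1)] .
  also have "\<dots> = sum ?w T" by (intro sum.cong) (auto simp: short)
  finally have "connection_cost w V \<le> connection_cost ?w V" using T(2) by simp
  moreover have "connection_cost ?w V \<le> connection_cost w V"
    using fin by (intro connection_cost_mono) auto
  ultimately show ?thesis by simp
qed

lemma connection_cost_insert_le:
  assumes fin: "finite V" and i: "i \<notin> V" and v: "v \<in> V"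
    and w: "0 \<le> w {i, v}"
  shows "connection_cost w (insert i V) \<le> connection_cost w V + w {i, v}"
proof -
  obtain T where T: "T \<in> connected_edge_sets V" "sum w T = connection_cost w V"
    using connection_cost_attained[OF fin, of w] by blast
  let ?T = "insert {i, v} T"
  have con: "graph_connected V T" and TV: "T \<subseteq> complete_edges V"
    using T(1) by (auto simp: connected_edge_sets_def)
  have toV: "(v, u) \<in> (adj ?T)\<^sup>*" if "u \<in> insert i V" for u
  proof (cases "u = i")
    case True
    then have "(v, u) \<in> adj ?T" by (simp add: insert_commute)
    then show ?thesis by (rule r_into_rtrancl)
  next
    case False
    then have "(v, u) \<in> (adj T)\<^sup>*" using con v that by (auto simp: graph_connected_def)
    moreover have "(adj T)\<^sup>* \<subseteq> (adj ?T)\<^sup>*" by (intro rtrancl_mono) auto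
    ultimately show ?thesis by auto
  qed
  have "graph_connected (insert i V) ?T"
    unfolding graph_connected_def
  proof (intro ballI)
    fix a b assume "a \<in> insert i V" "b \<in> insert i V"
    then show "(a, b) \<in> (adj ?T)\<^sup>*"
      using rtrancl_trans[OF adj_rtrancl_sym[OF toV] toV] by blast
  qed
  then have T': "?T \<in> connected_edge_sets (insert i V)"
    using TV v i complete_edges_mono[of V "insert i V"]
    by (auto simp: connected_edge_sets_def mem_complete_edges)
  have "{i, v} \<notin> T" using TV i by (auto simp: complete_edges_def doubleton_eq_iff)
  then have "sum w ?T = sum w T + w {i, v}"
    using finite_connected_edge_set[OF fin T(1)] by simp
  with connection_cost_le[OF _ T', of w] T fin show ?thesis by simp
qed

lemma connection_cost_trivial:
  assumes "complete_edges V = {}" "V \<subseteq> {i}"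
  shows "connection_cost w V = 0"
proof -
  have "graph_connected V {}"
    using assms(2) unfolding graph_connected_def by blast
  then have "connected_edge_sets V = {{}}"
    unfolding connected_edge_sets_def assms(1) by blast
  then show ?thesis by (simp add: connection_cost_def)
qed

lemma connection_cost_empty: "connection_cost w {} = 0"
  by (rule connection_cost_trivial) (simp_all add: complete_edges_def)

lemma connection_cost_singleton: "connection_cost w {i} = 0"
  by (rule connection_cost_trivial[of _ i]) (simp_all add: complete_edges_def)

text \<open>
  In a cheapest set with the smallest possible degree at \<open>i\<close>, an edge \<open>{i, z}\<close> cannot be exchanged
  for \<open>{y, z}\<close> with another neighbour \<open>y\<close> of \<open>i\<close>. Hence neighbours are more expensive to join to each
  other than to \<open>i\<close>, which is the separation that \<open>star\<close> may use. Removing \<open>i\<close> and joining its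
  neighbours by a star keeps the remaining vertices connected.
\<close>
lemma connection_cost_remove:
  fixes w :: "'v set \<Rightarrow> real"
  assumes fin: "finite V" and i: "i \<notin> V"
    and w: "\<And>e. e \<in> complete_edges (insert i V) \<Longrightarrow> 0 \<le> w e"
    and star: "\<And>N. N \<subseteq> V \<Longrightarrow> N \<noteq> {} \<Longrightarrow>
      (\<And>y z. y \<in> N \<Longrightarrow> z \<in> N \<Longrightarrow> y \<noteq> z \<Longrightarrow> max (w {i, y}) (w {i, z}) < w {y, z}) \<Longrightarrow>
      \<exists>y\<in>N. (\<Sum>z\<in>N - {y}. w {y, z}) \<le> B"
    and B: "0 \<le> B"
  shows "connection_cost w V \<le> connection_cost w (insert i V) + B"
proof -
  let ?I = "insert i V"
  define nb where "nb T = {y \<in> V. {i, y} \<in> T}" for T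
  have finI: "finite ?I" using fin by simp
  obtain T where T: "T \<in> connected_edge_sets ?I" "sum w T = connection_cost w ?I"
    and fewest: "\<forall>T'\<in>connected_edge_sets ?I. sum w T' \<le> sum w T \<longrightarrow> card (nb T) \<le> card (nb T')"
    using connection_cost_attained_minimal[OF finI, of w "\<lambda>T. card (nb T)"] by blast
  have finT: "finite T" using finite_connected_edge_set[OF finI T(1)] .
  have con: "graph_connected ?I T" and TV: "T \<subseteq> complete_edges ?I"
    using T(1) by (auto simp: connected_edge_sets_def)
  have wT: "0 \<le> w e" if "e \<in> T" for e using that TV w by auto
  have sep: "w {i, z} < w {y, z}" if yz: "y \<in> nb T" "z \<in> nb T" "y \<noteq> z" for y z
  proof (rule ccontr)
    assume le: "\<not> w {i, z} < w {y, z}"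
    let ?T = "T - {{i, z}}" let ?T' = "insert {y, z} ?T"
    have "y \<in> V" "z \<in> V" "{i, y} \<in> T" "{i, z} \<in> T" using yz by (auto simp: nb_def)
    then have ne: "{i, y} \<noteq> {i, z}" using yz by (auto simp: doubleton_eq_iff)
    have "(i, y) \<in> adj ?T'" "(y, z) \<in> adj ?T'" using ne \<open>{i, y} \<in> T\<close> by auto
    then have path: "(i, z) \<in> (adj ?T')\<^sup>*" by (meson converse_rtrancl_into_rtrancl r_into_rtrancl)
    have "graph_connected ?I ?T'"
    proof (rule graph_connected_transfer[OF con])
      fix c d assume cd: "{c, d} \<in> T"
      show "(c, d) \<in> (adj ?T')\<^sup>*"
      proof (cases "{c, d} = {i, z}")
        case True
        then have "c = i \<and> d = z \<or> c = z \<and> d = i" by (simp add: doubleton_eq_iff)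
        then show ?thesis using path adj_rtrancl_sym by fast
      next
        case False
        then have "(c, d) \<in> adj ?T'" using cd by simp
        then show ?thesis by (rule r_into_rtrancl)
      qed
    qed
    then have T': "?T' \<in> connected_edge_sets ?I"
      using TV \<open>y \<in> V\<close> \<open>z \<in> V\<close> \<open>y \<noteq> z\<close> by (auto simp: connected_edge_sets_def mem_complete_edges)
    have "sum w ?T' \<le> sum w ?T + w {y, z}"
    proof (cases "{y, z} \<in> ?T")
      case True
      then show ?thesis using wT by (simp add: insert_absorb del: insert_Diff_single)
    next
      case False
      then show ?thesis using finT by (subst sum.insert) auto
    qed
    also have "\<dots> \<le> sum w ?T + w {i, z}" using le by simp
    also have "\<dots> = sum w T" using finT \<open>{i, z} \<in> T\<close> by (simp add: sum.remove)
    finally have "card (nb T) \<le> card (nb ?T')" by (rule fewest[rule_format, OF T'])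
    moreover have "nb ?T' \<subset> nb T"
      using yz i by (auto simp: nb_def doubleton_eq_iff)
    then have "card (nb ?T') < card (nb T)"
      by (intro psubset_card_mono) (auto simp: nb_def fin)
    ultimately show False by simp
  qed
  show ?thesis
  proof (cases "V = {}")
    case True
    then show ?thesis using B by (simp add: connection_cost_empty connection_cost_singleton)
  next
    case False
    then obtain v where v: "v \<in> V" by auto
    then have "(i, v) \<in> (adj T)\<^sup>*" "i \<noteq> v" using con i by (auto simp: graph_connected_def)
    then obtain y where "{i, y} \<in> T" by (auto elim: converse_rtranclE)
    then have "y \<in> nb T" using TV i by (auto simp: nb_def mem_complete_edges dest: subsetD)
    then have "nb T \<noteq> {}" by auto
    moreover have "max (w {i, y}) (w {i, z}) < w {y, z}" if "y \<in> nb T" "z \<in> nb T" "y \<noteq> z" for y z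
      using sep[of y z] sep[of z y] that by (simp add: insert_commute)
    ultimately obtain c where c: "c \<in> nb T" "(\<Sum>z\<in>nb T - {c}. w {c, z}) \<le> B"
      using star[of "nb T"] by (auto simp: nb_def)
    let ?S = "(\<lambda>z. {c, z}) ` (nb T - {c})"
    let ?T0 = "{e \<in> T. i \<notin> e}"
    \<comment> \<open>Redirecting \<open>i\<close> to the centre \<open>c\<close> of the star maps walks in \<open>T\<close> to walks that avoid \<open>i\<close>.\<close>
    define \<pi> where "\<pi> u = (if u = i then c else u)" for u
    have edge_path: "(\<pi> a, \<pi> b) \<in> (adj (?T0 \<union> ?S))\<^sup>*" if "{a, b} \<in> T" for a b
    proof -
      have ab: "a \<in> ?I" "b \<in> ?I" "a \<noteq> b"
        using subsetD[OF TV that] by (auto simp: mem_complete_edges)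
      have *: "(c, z) \<in> (adj (?T0 \<union> ?S))\<^sup>*" if "z \<in> nb T" for z
        using that by (cases "z = c") auto
      consider "a = i" | "b = i" | "a \<noteq> i" "b \<noteq> i" by blast
      then show ?thesis
      proof cases
        case 1
        then have "b \<in> nb T" using ab that by (auto simp: nb_def)
        then show ?thesis using * 1 ab by (auto simp: \<pi>_def)
      next
        case 2
        then have "a \<in> nb T" using ab that by (auto simp: nb_def insert_commute)
        then show ?thesis using adj_rtrancl_sym[OF *] 2 ab by (auto simp: \<pi>_def)
      next
        case 3
        then have "(a, b) \<in> adj (?T0 \<union> ?S)" using that by auto
        then show ?thesis using 3 by (auto simp: \<pi>_def)
      qed
    qed
    have path: "(\<pi> a, \<pi> b) \<in> (adj (?T0 \<union> ?S))\<^sup>*" if "(a, b) \<in> (adj T)\<^sup>*" for a b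
      using that
    proof induction
      case (step b d)
      then have "{b, d} \<in> T" by simp
      from rtrancl_trans[OF step.IH edge_path[OF this]] show ?case .
    qed auto
    have "graph_connected V (?T0 \<union> ?S)"
      unfolding graph_connected_def
    proof (intro ballI)
      fix u v assume "u \<in> V" "v \<in> V"
      then have "(\<pi> u, \<pi> v) \<in> (adj (?T0 \<union> ?S))\<^sup>*"
        using con by (intro path) (auto simp: graph_connected_def)
      moreover have "\<pi> u = u" "\<pi> v = v" using i \<open>u \<in> V\<close> \<open>v \<in> V\<close> by (auto simp: \<pi>_def)
      ultimately show "(u, v) \<in> (adj (?T0 \<union> ?S))\<^sup>*" by simp
    qed
    moreover have SV: "?S \<subseteq> complete_edges V" using c by (auto simp: nb_def mem_complete_edges)
    moreover have "e \<in> complete_edges V" if "e \<in> T" "i \<notin> e" for e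
      using subsetD[OF TV that(1)] that(2) unfolding complete_edges_def by blast
    then have "?T0 \<subseteq> complete_edges V" by blast
    ultimately have T': "?T0 \<union> ?S \<in> connected_edge_sets V" by (auto simp: connected_edge_sets_def)
    have finnb: "finite (nb T)" using fin by (auto simp: nb_def)
    have wS: "0 \<le> w e" if "e \<in> ?S" for e
      using subsetD[OF SV that] complete_edges_mono[of V ?I] by (intro w) blast
    have "connection_cost w V \<le> sum w (?T0 \<union> ?S)" using connection_cost_le[OF fin T'] .
    also have "\<dots> \<le> sum w ?T0 + sum w ?S"
      using finT finnb wT by (subst sum.union_inter[symmetric]) (auto intro!: sum_nonneg)
    also have "sum w ?S = (\<Sum>z\<in>nb T - {c}. w {c, z})"
      by (subst sum.reindex) (auto simp: inj_on_def doubleton_eq_iff)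
    also have "sum w ?T0 \<le> sum w T" using finT wT by (intro sum_mono2) auto
    finally show ?thesis using c T(2) by simp
  qed
qed

section \<open>Sums over separated points\<close>

text \<open>
  A finite cover of the unit ball by balls of radius \<open>\<rho> / 2\<close> has at most one of the points in each
  of its members. The size of the cover does not depend on the points.
\<close>
lemma card_separated_bounded:
  fixes \<rho> :: real
  assumes "0 < \<rho>"
  obtains N :: nat where "\<And>(I :: 'i set) (g :: 'i \<Rightarrow> 'a::heine_borel).
    (\<And>i. i \<in> I \<Longrightarrow> g i \<in> cball c 1) \<Longrightarrow>
    (\<And>i j. i \<in> I \<Longrightarrow> j \<in> I \<Longrightarrow> i \<noteq> j \<Longrightarrow> \<rho> \<le> dist (g i) (g j)) \<Longrightarrow> card I \<le> N"
proof -
  obtain k where k: "finite k" "cball c 1 \<subseteq> (\<Union>x\<in>k. ball x (\<rho> / 2))"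
    using compact_cball[of c 1] assms by (auto simp: compact_eq_totally_bounded elim!: allE[of _ "\<rho> / 2"])
  have "card I \<le> card k"
    if I: "\<And>i. i \<in> I \<Longrightarrow> g i \<in> cball c 1"
      "\<And>i j. i \<in> I \<Longrightarrow> j \<in> I \<Longrightarrow> i \<noteq> j \<Longrightarrow> \<rho> \<le> dist (g i) (g j)" for I :: "'i set" and g :: "'i \<Rightarrow> 'a"
  proof -
    have "\<exists>x\<in>k. dist x (g i) < \<rho> / 2" if "i \<in> I" for i using I(1)[OF that] k(2) by fastforce
    then obtain \<phi> where \<phi>: "\<And>i. i \<in> I \<Longrightarrow> \<phi> i \<in> k \<and> dist (\<phi> i) (g i) < \<rho> / 2" by metis
    have "inj_on \<phi> I"
    proof (rule inj_onI, rule ccontr)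
      fix i j assume ij: "i \<in> I" "j \<in> I" "\<phi> i = \<phi> j" "i \<noteq> j"
      have "dist (g i) (g j) < \<rho>"
        using dist_triangle_half_r[of "\<phi> i" "g i" \<rho> "g j"] \<phi>[of i] \<phi>[of j] ij by simp
      with I(2)[of i j] ij show False by simp
    qed
    then show ?thesis using \<phi> k(1) by (intro card_inj_on_le) auto
  qed
  then show ?thesis by (rule that)
qed

text \<open>
  If every dyadic shell has at most \<open>N\<close> members, the sum is dominated by a geometric series. The
  induction removes the outermost nonempty shell, whose radius is the largest value of \<open>d\<close>.
\<close>
lemma sum_powr_dyadic:
  fixes d :: "'i \<Rightarrow> real"
  assumes "finite I" and \<alpha>: "0 < \<alpha>" and N: "\<And>s. 0 < s \<Longrightarrow> card {i \<in> I. s / 2 < d i \<and> d i \<le> s} \<le> N"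
    and "\<And>i. i \<in> I \<Longrightarrow> 0 \<le> d i" "\<And>i. i \<in> I \<Longrightarrow> d i \<le> R" "0 \<le> R"
  shows "(\<Sum>i\<in>I. d i powr \<alpha>) \<le> real N / (1 - 2 powr (- \<alpha>)) * R powr \<alpha>"
  using assms(1,3-6)
proof (induction I arbitrary: R rule: finite_psubset_induct)
  case (psubset I)
  define q where "q = 2 powr (- \<alpha>)"
  have q: "0 < q" "q < 1" using \<alpha> by (auto simp: q_def powr_minus field_simps)
  show ?case
  proof (cases "\<forall>i\<in>I. d i = 0")
    case True
    then show ?thesis using q by (auto simp: q_def[symmetric])
  next
    case False
    then have ne: "I \<noteq> {}" by auto
    define s where "s = Max (d ` I)"
    have s_ge: "d i \<le> s" if "i \<in> I" for i unfolding s_def using that psubset.hyps by auto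
    have "s \<in> d ` I" unfolding s_def using ne psubset.hyps by (intro Max_in) auto
    then obtain i0 where i0: "i0 \<in> I" "d i0 = s" by (metis imageE)
    have s0: "0 < s" using False psubset.prems(2) s_ge by (metis less_eq_real_def order_less_le_trans)
    have sR: "s \<le> R" using i0 psubset.prems(3) by auto
    define A where "A = {i \<in> I. s / 2 < d i \<and> d i \<le> s}"
    have A: "A \<subseteq> I" "i0 \<in> A" using i0 s0 by (auto simp: A_def)
    have "(\<Sum>i\<in>I - A. d i powr \<alpha>) \<le> real N / (1 - q) * (s / 2) powr \<alpha>"
      unfolding q_def
    proof (rule psubset.IH)
      show "I - A \<subset> I" using A by auto
      fix t :: real assume "0 < t"
      have "card {i \<in> I - A. t / 2 < d i \<and> d i \<le> t} \<le> card {i \<in> I. t / 2 < d i \<and> d i \<le> t}"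
        using psubset.hyps by (intro card_mono) auto
      with psubset.prems(1)[OF \<open>0 < t\<close>] show "card {i \<in> I - A. t / 2 < d i \<and> d i \<le> t} \<le> N" by simp
    qed (use psubset.prems s0 s_ge in \<open>auto simp: A_def not_less\<close>)
    moreover have "(\<Sum>i\<in>A. d i powr \<alpha>) \<le> real N * s powr \<alpha>"
    proof -
      have "(\<Sum>i\<in>A. d i powr \<alpha>) \<le> (\<Sum>i\<in>A. s powr \<alpha>)"
        using \<alpha> psubset.prems(2) by (intro sum_mono powr_mono2) (auto simp: A_def)
      also have "\<dots> = real (card A) * s powr \<alpha>" by simp
      also have "\<dots> \<le> real N * s powr \<alpha>"
        using psubset.prems(1)[OF s0] by (intro mult_right_mono) (auto simp: A_def)
      finally show ?thesis .
    qed
    moreover have "(\<Sum>i\<in>I. d i powr \<alpha>) = (\<Sum>i\<in>I - A. d i powr \<alpha>) + (\<Sum>i\<in>A. d i powr \<alpha>)"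
      using psubset.hyps A(1) by (intro sum.subset_diff) auto
    moreover have "(s / 2) powr \<alpha> = q * s powr \<alpha>"
      using s0 by (simp add: q_def powr_divide powr_minus field_simps)
    moreover have "real N / (1 - q) * (q * s powr \<alpha>) + real N * s powr \<alpha> = real N / (1 - q) * s powr \<alpha>"
      using q by (simp add: field_simps)
    moreover have "real N / (1 - q) * s powr \<alpha> \<le> real N / (1 - q) * R powr \<alpha>"
      using sR s0 \<alpha> q by (intro mult_left_mono powr_mono2) auto
    ultimately show ?thesis by (simp add: q_def[symmetric])
  qed
qed

text \<open>
  The hypothesis on pairs is scale invariant, so that rescaling a dyadic shell around \<open>p\<close> to unit
  size yields \<open>\<rho> / 2\<close>-separated points; the number of points in a shell is therefore bounded,
  although the number of shells is not.
\<close>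
lemma separated_star_bound:
  fixes \<rho> \<alpha> :: real
  assumes "0 < \<rho>" "0 < \<alpha>"
  obtains K where "0 \<le> K" "\<And>(N :: 'i set) (z :: 'i \<Rightarrow> 'a::euclidean_space) p R.
    finite N \<Longrightarrow> 0 \<le> R \<Longrightarrow> (\<And>i. i \<in> N \<Longrightarrow> dist p (z i) \<le> R) \<Longrightarrow>
    (\<And>i j. i \<in> N \<Longrightarrow> j \<in> N \<Longrightarrow> i \<noteq> j \<Longrightarrow> \<rho> * dist p (z i) \<le> dist (z i) (z j)) \<Longrightarrow>
    (\<Sum>i\<in>N. dist p (z i) powr \<alpha>) \<le> K * R powr \<alpha>"
proof -
  from assms have "0 < \<rho> / 2" by simp
  then obtain M where M: "\<And>(I :: 'i set) (g :: 'i \<Rightarrow> 'a).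
    (\<And>i. i \<in> I \<Longrightarrow> g i \<in> cball 0 1) \<Longrightarrow>
    (\<And>i j. i \<in> I \<Longrightarrow> j \<in> I \<Longrightarrow> i \<noteq> j \<Longrightarrow> \<rho> / 2 \<le> dist (g i) (g j)) \<Longrightarrow> card I \<le> M"
    using card_separated_bounded[of "\<rho> / 2" 0] by metis
  show ?thesis
  proof (rule that)
    show "0 \<le> real M / (1 - 2 powr (- \<alpha>))" using assms by (auto simp: powr_minus field_simps)
    fix N :: "'i set" and z :: "'i \<Rightarrow> 'a" and p R
    assume N: "finite N" "0 \<le> R" "\<And>i. i \<in> N \<Longrightarrow> dist p (z i) \<le> R"
      "\<And>i j. i \<in> N \<Longrightarrow> j \<in> N \<Longrightarrow> i \<noteq> j \<Longrightarrow> \<rho> * dist p (z i) \<le> dist (z i) (z j)"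
    show "(\<Sum>i\<in>N. dist p (z i) powr \<alpha>) \<le> real M / (1 - 2 powr (- \<alpha>)) * R powr \<alpha>"
    proof (rule sum_powr_dyadic[OF N(1) assms(2)])
      fix s :: real assume s: "0 < s"
      show "card {i \<in> N. s / 2 < dist p (z i) \<and> dist p (z i) \<le> s} \<le> M"
      proof (rule M[of _ "\<lambda>i. (1 / s) *\<^sub>R (z i - p)"])
        fix i assume "i \<in> {i \<in> N. s / 2 < dist p (z i) \<and> dist p (z i) \<le> s}"
        then show "(1 / s) *\<^sub>R (z i - p) \<in> cball 0 1"
          using s by (simp add: dist_norm norm_minus_commute)
      next
        fix i j assume ij: "i \<in> {i \<in> N. s / 2 < dist p (z i) \<and> dist p (z i) \<le> s}"
          "j \<in> {i \<in> N. s / 2 < dist p (z i) \<and> dist p (z i) \<le> s}" "i \<noteq> j"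
        have "\<rho> * (s / 2) \<le> \<rho> * dist p (z i)" using ij assms by (intro mult_left_mono) auto
        also have "\<dots> \<le> dist (z i) (z j)" using N(4) ij by auto
        finally have "\<rho> / 2 \<le> dist (z i) (z j) / s" using s by (simp add: field_simps)
        also have "\<dots> = dist ((1 / s) *\<^sub>R (z i - p)) ((1 / s) *\<^sub>R (z j - p))"
          using s by (simp add: dist_norm flip: scaleR_diff_right)
        finally show "\<rho> / 2 \<le> dist ((1 / s) *\<^sub>R (z i - p)) ((1 / s) *\<^sub>R (z j - p))" .
      qed
    qed (use N in auto)
  qed
qed

section \<open>Cuts of dense point sets and the grid of cells\<close>

text \<open>
  The \<open>\<delta>\<close>-balls around the two classes of points are two closed sets that cover the connected set \<open>S\<close>,
  hence they meet in a point of \<open>S\<close>, which is \<open>\<delta>\<close>-close to both classes.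
\<close>
lemma dense_points_cut:
  fixes S :: "'a::metric_space set"
  assumes S: "connected S" and I: "finite I" "\<And>i. i \<in> I \<Longrightarrow> x i \<in> S"
    and dense: "\<And>p. p \<in> S \<Longrightarrow> \<exists>i\<in>I. dist p (x i) \<le> \<delta>"
    and A: "A \<subseteq> I" "A \<noteq> {}" "A \<noteq> I"
  shows "\<exists>u\<in>A. \<exists>v\<in>I - A. dist (x u) (x v) \<le> 2 * \<delta>"
proof (rule ccontr)
  assume far: "\<not> ?thesis"
  let ?U = "\<lambda>B. \<Union>u\<in>B. cball (x u) \<delta>"
  obtain a b where ab: "a \<in> A" "b \<in> I - A" using A by auto
  have \<delta>: "0 \<le> \<delta>" using dense[of "x a"] ab A I(2) by (meson order_trans subsetD zero_le_dist)
  have "closed (?U A)" "closed (?U (I - A))"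
    using A I finite_subset by (auto intro!: closed_UN)
  moreover have "S \<subseteq> ?U A \<union> ?U (I - A)" using dense by (force simp: dist_commute)
  moreover have "?U A \<inter> ?U (I - A) \<inter> S = {}"
  proof (rule ccontr)
    assume "?U A \<inter> ?U (I - A) \<inter> S \<noteq> {}"
    then obtain p where "p \<in> ?U A" "p \<in> ?U (I - A)" by blast
    then obtain u v where "u \<in> A" "v \<in> I - A" "dist (x u) p \<le> \<delta>" "dist (x v) p \<le> \<delta>"
      unfolding UN_iff mem_cball by blast
    moreover from this have "dist (x u) (x v) \<le> 2 * \<delta>"
      using dist_triangle2[of "x u" "x v" p] by linarith
    ultimately show False using far by blast
  qed
  moreover have "x a \<in> cball (x a) \<delta> \<inter> S" "x b \<in> cball (x b) \<delta> \<inter> S" using ab A I \<delta> by auto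
  then have "?U A \<inter> S \<noteq> {}" "?U (I - A) \<inter> S \<noteq> {}" using ab by blast+
  ultimately show False using S unfolding connected_closed by blast
qed

definition grid_cell :: "nat \<Rightarrow> (2 \<Rightarrow> nat) \<Rightarrow> (real^2) set" where
  "grid_cell m k = cbox (\<chi> i. real (k i) / real m) (\<chi> i. (real (k i) + 1) / real m)"

definition grid_indices :: "nat \<Rightarrow> (2 \<Rightarrow> nat) set" where
  "grid_indices m = (UNIV \<rightarrow>\<^sub>E {..<m})"

lemma finite_grid_indices: "finite (grid_indices m)"
  by (auto simp: grid_indices_def intro!: finite_PiE)

lemma card_grid_indices: "card (grid_indices m) = m\<^sup>2"
  by (simp add: grid_indices_def card_PiE)

lemma grid_cell_subset: "k \<in> grid_indices m \<Longrightarrow> grid_cell m k \<subseteq> unit_square"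
proof -
  assume "k \<in> grid_indices m"
  then have k: "k i < m" for i by (auto simp: grid_indices_def)
  have "real (k i) + 1 \<le> real m" for i using k[of i] by linarith
  then have le1: "(real (k i) + 1) / real m \<le> 1" for i
    using k[of i] by (auto simp: divide_le_eq_1)
  have ge0: "0 \<le> real (k i) / real m" for i by simp
  show ?thesis
    unfolding grid_cell_def unit_square_def
    by (force simp: mem_box_cart intro: order_trans[OF ge0] order_trans[OF _ le1])
qed

lemma measure_grid_cell: "0 < m \<Longrightarrow> measure lborel (grid_cell m k) = 1 / (real m)\<^sup>2"
proof -
  assume m: "0 < m"
  have "measure lborel (grid_cell m k) = (\<Prod>i\<in>(UNIV :: 2 set). 1 / real m)"
    unfolding grid_cell_def
    by (subst content_cbox_cart) (use m in \<open>auto simp: interval_ne_empty_cart field_simps intro!: prod.cong\<close>)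
  then show ?thesis by (simp add: power_divide)
qed

lemma unit_square_covered:
  assumes m: "0 < m" and p: "p \<in> unit_square"
  shows "\<exists>k\<in>grid_indices m. p \<in> grid_cell m k"
proof -
  \<comment> \<open>The minimum takes care of the points with a coordinate equal to \<open>1\<close>.\<close>
  define k where "k i = min (nat \<lfloor>real m * p $ i\<rfloor>) (m - 1)" for i
  have p01: "0 \<le> p $ i" "p $ i \<le> 1" for i using p by (auto simp: unit_square_def mem_box_cart)
  have "k \<in> grid_indices m" using m by (auto simp: grid_indices_def k_def)
  moreover have "real (k i) / real m \<le> p $ i \<and> p $ i \<le> (real (k i) + 1) / real m" for i
  proof -
    define t where "t = real m * p $ i"
    have t: "0 \<le> t" "t \<le> real m" using p01[of i] m by (auto simp: t_def mult_left_le)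
    have "real (k i) \<le> t" "t \<le> real (k i) + 1"
      using t m unfolding k_def t_def[symmetric] min_def by (simp_all add: of_nat_diff) linarith+
    then show ?thesis using m by (simp add: t_def field_simps)
  qed
  ultimately show ?thesis by (auto simp: grid_cell_def mem_box_cart intro!: bexI[of _ k])
qed

lemma dist_grid_cell:
  assumes "p \<in> grid_cell m k" "q \<in> grid_cell m k"
  shows "dist p q \<le> 2 / real m"
proof -
  have "\<bar>(p - q) $ i\<bar> \<le> 1 / real m" for i
    using assms by (auto simp: grid_cell_def mem_box_cart abs_le_iff add_divide_distrib
        dest!: spec[of _ i])
  then have "(\<Sum>i\<in>UNIV. \<bar>(p - q) $ i\<bar>) \<le> (\<Sum>i\<in>(UNIV :: 2 set). 1 / real m)"
    by (intro sum_mono) auto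
  then show ?thesis using norm_le_l1_cart[of "p - q"] by (simp add: dist_norm)
qed

lemma occupied_cells_cut:
  assumes m: "0 < m" and I: "finite I" "\<And>i. i \<in> I \<Longrightarrow> x i \<in> unit_square"
    and occ: "\<And>k. k \<in> grid_indices m \<Longrightarrow> \<exists>i\<in>I. x i \<in> grid_cell m k"
    and A: "A \<subseteq> I" "A \<noteq> {}" "A \<noteq> I"
  shows "\<exists>u\<in>A. \<exists>v\<in>I - A. dist (x u) (x v) \<le> 4 / real m"
proof -
  have "\<exists>i\<in>I. dist p (x i) \<le> 2 / real m" if "p \<in> unit_square" for p
    using unit_square_covered[OF m that] occ dist_grid_cell by blast
  moreover have "connected unit_square" by (simp add: unit_square_def convex_connected)
  ultimately show ?thesis using dense_points_cut[of unit_square I x "2 / real m" A] I A by simp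
qed

section \<open>The bounded differences inequality\<close>

lemma (in prob_space) abs_expectation_le:
  fixes f :: "'a \<Rightarrow> real"
  assumes "f \<in> borel_measurable M" "\<And>x. x \<in> space M \<Longrightarrow> \<bar>f x\<bar> \<le> B"
  shows "\<bar>expectation f\<bar> \<le> B"
proof -
  have int: "integrable M f"
    using assms by (intro integrable_const_bound[of f B] AE_I2) auto
  have "\<bar>expectation f\<bar> \<le> expectation (\<lambda>x. \<bar>f x\<bar>)" by (rule integral_abs_bound)
  also have "\<dots> \<le> expectation (\<lambda>_. B)" using assms int by (intro integral_mono) auto
  finally show ?thesis by (simp add: prob_space)
qed

text \<open>
  Integrating out one coordinate leaves a function \<open>G\<close> of the others with the same bound on its
  differences and the same mean. For fixed other coordinates, \<open>F - G\<close> is centred and ranges in an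
  interval of length \<open>2 * B\<close>, so that Hoeffding's lemma contributes one factor
  \<open>exp (l\<^sup>2 * B\<^sup>2 / 2)\<close> for each coordinate.
\<close>
lemma (in product_prob_space) exp_moment_bounded_differences:
  fixes F :: "('i \<Rightarrow> 'a) \<Rightarrow> real"
  assumes "finite J" "F \<in> borel_measurable (Pi\<^sub>M J M)"
    and "\<And>x. x \<in> space (Pi\<^sub>M J M) \<Longrightarrow> \<bar>F x\<bar> \<le> K"
    and "\<And>x i y. x \<in> space (Pi\<^sub>M J M) \<Longrightarrow> i \<in> J \<Longrightarrow> y \<in> space (M i) \<Longrightarrow> \<bar>F (x(i := y)) - F x\<bar> \<le> B"
    and l: "0 < l"
  shows "(\<integral>\<^sup>+x. ennreal (exp (l * (F x - integral\<^sup>L (Pi\<^sub>M J M) F))) \<partial>Pi\<^sub>M J M)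
    \<le> ennreal (exp (l\<^sup>2 * B\<^sup>2 / 2 * real (card J)))"
  using assms(1-4)
proof (induction J arbitrary: F rule: finite_induct)
  case empty
  show ?case
    by (simp add: PiM_empty nn_integral_count_space_finite lebesgue_integral_count_space_finite)
next
  case (insert i J)
  note F[measurable] = insert.prems(1)
  let ?PJ = "Pi\<^sub>M J M" and ?PI = "Pi\<^sub>M (insert i J) M"
  interpret PJ: prob_space ?PJ by (intro prob_space_PiM prob_space)
  interpret PI: prob_space ?PI by (intro prob_space_PiM prob_space)
  define G where "G x = (\<integral>y. F (x(i := y)) \<partial>M i)" for x
  have upd: "x(i := y) \<in> space ?PI" if "x \<in> space ?PJ" "y \<in> space (M i)" for x y
    using that insert.hyps by (auto simp: space_PiM PiE_iff extensional_def)
  have F2: "(\<lambda>(x, y). F (x(i := y))) \<in> borel_measurable (?PJ \<Otimes>\<^sub>M M i)"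
    using measurable_compose[OF measurable_add_dim[of i J M] F] by (simp add: case_prod_beta)
  have Fx: "(\<lambda>y. F (x(i := y))) \<in> borel_measurable (M i)" if "x \<in> space ?PJ" for x
    using measurable_compose[OF measurable_Pair1'[OF that] F2] by simp
  have Fb: "\<bar>F (x(i := y))\<bar> \<le> K" if "x \<in> space ?PJ" "y \<in> space (M i)" for x y
    by (rule insert.prems(2)) (rule upd[OF that])
  have Fx_int: "integrable (M i) (\<lambda>y. F (x(i := y)))" if "x \<in> space ?PJ" for x
    by (rule M.integrable_const_bound[of _ K]) (use Fx[OF that] Fb[OF that] in \<open>auto simp del: fun_upd_apply\<close>)
  have G: "G \<in> borel_measurable ?PJ"
    unfolding G_def by (rule M.borel_measurable_lebesgue_integral) (use F2 in simp)
  have F_int: "integrable ?PI F"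
    using insert.prems(2) by (intro PI.integrable_const_bound[of _ K] AE_I2) auto
  have EF: "integral\<^sup>L ?PI F = integral\<^sup>L ?PJ G"
    unfolding G_def using insert.hyps F_int by (intro product_integral_insert) auto
  have G_bound: "\<bar>G x\<bar> \<le> K" if "x \<in> space ?PJ" for x
    unfolding G_def by (rule M.abs_expectation_le[OF Fx[OF that] Fb[OF that]])
  have G_diff: "\<bar>G (x(j := z)) - G x\<bar> \<le> B"
    if "x \<in> space ?PJ" "j \<in> J" "z \<in> space (M j)" for x j z
  proof -
    have xz: "x(j := z) \<in> space ?PJ" using that by (auto simp: space_PiM PiE_iff extensional_def)
    have ji: "j \<noteq> i" using that insert.hyps by auto
    have "G (x(j := z)) - G x = (\<integral>y. F ((x(j := z))(i := y)) - F (x(i := y)) \<partial>M i)"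
      unfolding G_def using Fx_int xz that by simp
    also have "\<bar>\<dots>\<bar> \<le> B"
    proof (rule M.abs_expectation_le)
      show "(\<lambda>y. F ((x(j := z))(i := y)) - F (x(i := y))) \<in> borel_measurable (M i)"
        using Fx xz that by (intro borel_measurable_diff) auto
      fix y assume "y \<in> space (M i)"
      then show "\<bar>F ((x(j := z))(i := y)) - F (x(i := y))\<bar> \<le> B"
        unfolding fun_upd_twist[OF ji] using that by (intro insert.prems(3) upd) auto
    qed
    finally show ?thesis .
  qed
  have inner: "(\<integral>\<^sup>+y. ennreal (exp (l * (F (x(i := y)) - G x))) \<partial>M i) \<le> ennreal (exp (l\<^sup>2 * B\<^sup>2 / 2))"
    if x: "x \<in> space ?PJ" for x
  proof -
    obtain y0 where y0: "y0 \<in> space (M i)" using M.not_empty[of i] by auto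
    let ?c = "F (x(i := y0))"
    have rng: "F (x(i := y)) \<in> {?c - B..?c + B}" if "y \<in> space (M i)" for y
    proof -
      have "\<bar>F ((x(i := y0))(i := y)) - ?c\<bar> \<le> B"
        using that by (intro insert.prems(3) upd x y0) auto
      then show ?thesis unfolding fun_upd_upd by auto
    qed
    interpret H: interval_bounded_random_variable "M i" "\<lambda>y. F (x(i := y))" "?c - B" "?c + B"
      by unfold_locales (use Fx[OF x] rng in auto)
    have "l\<^sup>2 * (?c + B - (?c - B))\<^sup>2 / 8 = l\<^sup>2 * B\<^sup>2 / 2" by (simp add: power2_eq_square)
    with H.Hoeffdings_lemma_nn_integral[OF l] show ?thesis by (simp add: G_def mult.commute)
  qed
  have "(\<integral>\<^sup>+x. ennreal (exp (l * (F x - integral\<^sup>L ?PI F))) \<partial>?PI)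
    = (\<integral>\<^sup>+x. (\<integral>\<^sup>+y. ennreal (exp (l * (F (x(i := y)) - integral\<^sup>L ?PI F))) \<partial>M i) \<partial>?PJ)"
    using insert.hyps by (intro product_nn_integral_insert) auto
  also have "\<dots> = (\<integral>\<^sup>+x. ennreal (exp (l * (G x - integral\<^sup>L ?PJ G))) *
      (\<integral>\<^sup>+y. ennreal (exp (l * (F (x(i := y)) - G x))) \<partial>M i) \<partial>?PJ)"
  proof (rule nn_integral_cong)
    fix x assume x: "x \<in> space ?PJ"
    note [measurable] = Fx[OF x]
    show "(\<integral>\<^sup>+y. ennreal (exp (l * (F (x(i := y)) - integral\<^sup>L ?PI F))) \<partial>M i) =
      ennreal (exp (l * (G x - integral\<^sup>L ?PJ G))) *
      (\<integral>\<^sup>+y. ennreal (exp (l * (F (x(i := y)) - G x))) \<partial>M i)"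
      by (subst nn_integral_cmult[symmetric])
         (auto simp: EF algebra_simps simp flip: ennreal_mult exp_add intro!: nn_integral_cong)
  qed
  also have "\<dots> \<le> (\<integral>\<^sup>+x. ennreal (exp (l * (G x - integral\<^sup>L ?PJ G))) * ennreal (exp (l\<^sup>2 * B\<^sup>2 / 2)) \<partial>?PJ)"
    by (intro nn_integral_mono mult_left_mono inner) auto
  also have "\<dots> = (\<integral>\<^sup>+x. ennreal (exp (l * (G x - integral\<^sup>L ?PJ G))) \<partial>?PJ) * ennreal (exp (l\<^sup>2 * B\<^sup>2 / 2))"
    using G by (intro nn_integral_multc) auto
  also have "\<dots> \<le> ennreal (exp (l\<^sup>2 * B\<^sup>2 / 2 * real (card J))) * ennreal (exp (l\<^sup>2 * B\<^sup>2 / 2))"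
    using insert.IH[OF G G_bound G_diff] by (intro mult_right_mono) auto
  also have "\<dots> = ennreal (exp (l\<^sup>2 * B\<^sup>2 / 2 * real (card (insert i J))))"
    using insert.hyps by (simp add: algebra_simps flip: ennreal_mult exp_add)
  finally show ?case .
qed

text \<open>
  The exponential Markov inequality for the moment bound above.
\<close>
lemma (in product_prob_space) bounded_differences_upper_tail:
  fixes F :: "('i \<Rightarrow> 'a) \<Rightarrow> real"
  assumes J: "finite J" "J \<noteq> {}" and F[measurable]: "F \<in> borel_measurable (Pi\<^sub>M J M)"
    and bound: "\<And>x. x \<in> space (Pi\<^sub>M J M) \<Longrightarrow> \<bar>F x\<bar> \<le> K"
    and diff: "\<And>x i y. x \<in> space (Pi\<^sub>M J M) \<Longrightarrow> i \<in> J \<Longrightarrow> y \<in> space (M i) \<Longrightarrow>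
      \<bar>F (x(i := y)) - F x\<bar> \<le> B"
    and t: "0 < t" and B: "0 < B"
  shows "measure (Pi\<^sub>M J M) {x \<in> space (Pi\<^sub>M J M). t \<le> F x - integral\<^sup>L (Pi\<^sub>M J M) F}
    \<le> exp (- t\<^sup>2 / (2 * real (card J) * B\<^sup>2))"
proof -
  let ?P = "Pi\<^sub>M J M"
  interpret Q: prob_space ?P by (intro prob_space_PiM prob_space)
  define m where "m = integral\<^sup>L ?P F"
  define n where "n = real (card J)"
  have n: "0 < n" using J by (simp add: n_def card_gt_0_iff)
  \<comment> \<open>This \<open>l\<close> minimises \<open>- l * t + n * l\<^sup>2 * B\<^sup>2 / 2\<close>.\<close>
  define l where "l = t / (n * B\<^sup>2)"
  have l: "0 < l" using t B n by (simp add: l_def)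
  have "emeasure ?P {x \<in> space ?P. t \<le> F x - m}
      \<le> ennreal (exp (- l * t)) * (\<integral>\<^sup>+x. ennreal (exp (l * (F x - m))) * indicator (space ?P) x \<partial>?P)"
    by (intro Chernoff_ineq_nn_integral_ge l) auto
  also have "(\<integral>\<^sup>+x. ennreal (exp (l * (F x - m))) * indicator (space ?P) x \<partial>?P) =
      (\<integral>\<^sup>+x. ennreal (exp (l * (F x - m))) \<partial>?P)"
    by (intro nn_integral_cong) auto
  also have "\<dots> \<le> ennreal (exp (l\<^sup>2 * B\<^sup>2 / 2 * n))"
    unfolding m_def n_def by (rule exp_moment_bounded_differences) (use J bound diff l in auto)
  also have "ennreal (exp (- l * t)) * ennreal (exp (l\<^sup>2 * B\<^sup>2 / 2 * n)) =
      ennreal (exp (- l * t + l\<^sup>2 * B\<^sup>2 / 2 * n))"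
    by (simp add: ennreal_mult[symmetric] mult_exp_exp)
  also have "- l * t + l\<^sup>2 * B\<^sup>2 / 2 * n = - t\<^sup>2 / (2 * n * B\<^sup>2)"
    using n B by (simp add: l_def power2_eq_square field_simps)
  finally show ?thesis
    unfolding m_def n_def by (simp add: Q.emeasure_eq_measure mult_left_mono)
qed

text \<open>
  McDiarmid's inequality, up to the constant in the exponent.
\<close>
lemma (in product_prob_space) bounded_differences_tail:
  fixes F :: "('i \<Rightarrow> 'a) \<Rightarrow> real"
  assumes J: "finite J" "J \<noteq> {}" and F[measurable]: "F \<in> borel_measurable (Pi\<^sub>M J M)"
    and bound: "\<And>x. x \<in> space (Pi\<^sub>M J M) \<Longrightarrow> \<bar>F x\<bar> \<le> K"
    and diff: "\<And>x i y. x \<in> space (Pi\<^sub>M J M) \<Longrightarrow> i \<in> J \<Longrightarrow> y \<in> space (M i) \<Longrightarrow>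
      \<bar>F (x(i := y)) - F x\<bar> \<le> B"
    and t: "0 < t" and B: "0 < B"
  shows "measure (Pi\<^sub>M J M) {x \<in> space (Pi\<^sub>M J M). t \<le> \<bar>F x - integral\<^sup>L (Pi\<^sub>M J M) F\<bar>}
    \<le> 2 * exp (- t\<^sup>2 / (2 * real (card J) * B\<^sup>2))"
proof -
  let ?P = "Pi\<^sub>M J M" and ?e = "exp (- t\<^sup>2 / (2 * real (card J) * B\<^sup>2))"
  interpret Q: prob_space ?P by (intro prob_space_PiM prob_space)
  define m where "m = integral\<^sup>L ?P F"
  let ?U = "{x \<in> space ?P. t \<le> F x - m}" and ?L = "{x \<in> space ?P. t \<le> - F x - (- m)}"
  have "measure ?P ?U \<le> ?e"
    unfolding m_def by (rule bounded_differences_upper_tail) (use assms in auto)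
  moreover have "measure ?P {x \<in> space ?P. t \<le> - F x - integral\<^sup>L ?P (\<lambda>x. - F x)} \<le> ?e"
    using diff by (intro bounded_differences_upper_tail[where K = K]) (use assms in \<open>auto simp: abs_minus_commute\<close>)
  then have "measure ?P ?L \<le> ?e" by (simp add: m_def)
  moreover have "measure ?P (?U \<union> ?L) \<le> measure ?P ?U + measure ?P ?L"
    by (intro measure_Un_le) auto
  moreover have "{x \<in> space ?P. t \<le> \<bar>F x - m\<bar>} = ?U \<union> ?L" by auto
  ultimately show ?thesis unfolding m_def by simp
qed

section \<open>Minimal spanning trees with truncated weights\<close>

abbreviation truncated :: "('p \<Rightarrow> 'p \<Rightarrow> real) \<Rightarrow> real \<Rightarrow> 'p \<Rightarrow> 'p \<Rightarrow> real" where
  "truncated h r \<equiv> \<lambda>u v. min (h u v) r"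

lemma edge_weight_pair:
  assumes "h (x i) (x j) = h (x j) (x i)"
  shows "edge_weight h \<alpha> x {i, j} = h (x i) (x j) powr \<alpha>"
  using assms by (cases "i \<le> j") (auto simp: edge_weight_def min_def max_def)

lemma edge_weight_cong:
  "finite e \<Longrightarrow> e \<noteq> {} \<Longrightarrow> (\<And>i. i \<in> e \<Longrightarrow> x i = y i) \<Longrightarrow> edge_weight h \<alpha> x e = edge_weight h \<alpha> y e"
  by (simp add: edge_weight_def)

lemma complete_edgesE:
  assumes "e \<in> complete_edges V"
  obtains u v where "e = {u, v}" "u \<in> V" "v \<in> V" "u \<noteq> v"
  using assms unfolding complete_edges_def by blast

lemma min_powr: "0 \<le> a \<Longrightarrow> 0 \<le> r \<Longrightarrow> 0 < \<alpha> \<Longrightarrow> min a r powr \<alpha> = min (a powr \<alpha>) (r powr \<alpha>)"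
  for a r \<alpha> :: real
  using powr_mono2[of \<alpha> a r] powr_mono2[of \<alpha> r a] by (cases "a \<le> r") (auto simp: min_absorb1 min_absorb2)

locale distance_like =
  fixes S :: "(real^2) set" and h :: "real^2 \<Rightarrow> real^2 \<Rightarrow> real" and c\<^sub>1 c\<^sub>2 \<alpha> :: real
  assumes c\<^sub>1: "0 < c\<^sub>1" and c\<^sub>2: "0 < c\<^sub>2" and \<alpha>: "0 < \<alpha>"
    and h: "\<And>x y. x \<in> S \<Longrightarrow> y \<in> S \<Longrightarrow>
      0 \<le> h x y \<and> h x y = h y x \<and> c\<^sub>1 * dist x y \<le> h x y \<and> h x y \<le> c\<^sub>2 * dist x y"
begin

lemma truncated_weight_pair:
  assumes "x i \<in> S" "x j \<in> S"
  shows "edge_weight (truncated h r) \<alpha> x {i, j} = min (h (x i) (x j)) r powr \<alpha>"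
  using h[OF assms] by (intro edge_weight_pair) auto

text \<open>
  The separation of the neighbours in \<open>connection_cost_remove\<close> has two consequences for truncated
  weights. No neighbour is at the cut-off level, so that all are within distance \<open>r / c\<^sub>1\<close>; and
  the distance of two neighbours is at least \<open>c\<^sub>1 / c\<^sub>2\<close> times their distance to \<open>x i\<close>. By
  \<open>separated_star_bound\<close> the star at the nearest neighbour costs \<open>O(r powr \<alpha>)\<close>.
\<close>
lemma removal_cost:
  obtains K where "0 \<le> K" "\<And>(V :: nat set) i x r.
    finite V \<Longrightarrow> i \<notin> V \<Longrightarrow> (\<And>j. j \<in> insert i V \<Longrightarrow> x j \<in> S) \<Longrightarrow> 0 \<le> r \<Longrightarrow>
    connection_cost (edge_weight (truncated h r) \<alpha> x) V \<le>
    connection_cost (edge_weight (truncated h r) \<alpha> x) (insert i V) + K * r powr \<alpha>"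
proof -
  have "0 < c\<^sub>1 / c\<^sub>2" using c\<^sub>1 c\<^sub>2 by simp
  from separated_star_bound[OF this \<alpha>] obtain K where K: "0 \<le> K"
    and star: "\<And>(N :: nat set) (z :: nat \<Rightarrow> real^2) p R.
    finite N \<Longrightarrow> 0 \<le> R \<Longrightarrow> (\<And>i. i \<in> N \<Longrightarrow> dist p (z i) \<le> R) \<Longrightarrow>
    (\<And>i j. i \<in> N \<Longrightarrow> j \<in> N \<Longrightarrow> i \<noteq> j \<Longrightarrow> c\<^sub>1 / c\<^sub>2 * dist p (z i) \<le> dist (z i) (z j)) \<Longrightarrow>
    (\<Sum>i\<in>N. dist p (z i) powr \<alpha>) \<le> K * R powr \<alpha>" by metis
  define C where "C = (2 * c\<^sub>2 / c\<^sub>1) powr \<alpha> * K"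
  show ?thesis
  proof (rule that)
    show "0 \<le> C" using K by (simp add: C_def)
    fix V :: "nat set" and i :: nat and x :: "nat \<Rightarrow> real^2" and r :: real
    assume fin: "finite V" and i: "i \<notin> V" and xS: "\<And>j. j \<in> insert i V \<Longrightarrow> x j \<in> S" and r: "0 \<le> r"
    let ?w = "edge_weight (truncated h r) \<alpha> x"
    show "connection_cost ?w V \<le> connection_cost ?w (insert i V) + C * r powr \<alpha>"
    proof (rule connection_cost_remove[OF fin i])
      show "0 \<le> ?w e" for e by (simp add: edge_weight_def)
      show "0 \<le> C * r powr \<alpha>" using K by (simp add: C_def)
      fix N assume N: "N \<subseteq> V" "N \<noteq> {}"
        and sep: "\<And>y z. y \<in> N \<Longrightarrow> z \<in> N \<Longrightarrow> y \<noteq> z \<Longrightarrow> max (?w {i, y}) (?w {i, z}) < ?w {y, z}"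
      have finN: "finite N" using N fin finite_subset by blast
      have NS: "x z \<in> S" if "z \<in> N" for z using that N xS by blast
      have iS: "x i \<in> S" using xS by blast
      have cmp: "h (x i) (x z) < r \<and> h (x i) (x z) < h (x y) (x z)"
        if "y \<in> N" "z \<in> N" "y \<noteq> z" for y z
      proof -
        have "min (h (x i) (x z)) r powr \<alpha> < min (h (x y) (x z)) r powr \<alpha>"
          using sep[OF that] NS[OF that(1)] NS[OF that(2)] iS by (simp add: truncated_weight_pair)
        then have "\<not> min (h (x y) (x z)) r \<le> min (h (x i) (x z)) r"
          using powr_mono2[of \<alpha> "min (h (x y) (x z)) r" "min (h (x i) (x z)) r"] \<alpha> r
            h[OF NS[OF that(1)] NS[OF that(2)]] by auto
        then show ?thesis by auto
      qed
      obtain y where y: "y \<in> N" "\<And>z. z \<in> N \<Longrightarrow> dist (x i) (x y) \<le> dist (x i) (x z)"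
        using ex_is_arg_min_if_finite[OF finN N(2), of "\<lambda>z. dist (x i) (x z)"]
        unfolding is_arg_min_linorder by blast
      have far: "dist (x i) (x z) \<le> r / c\<^sub>1" if "z \<in> N" "w \<in> N" "w \<noteq> z" for z w
      proof -
        have "c\<^sub>1 * dist (x i) (x z) \<le> r" using cmp[OF that(2,1,3)] h[OF iS NS[OF that(1)]] by simp
        then show ?thesis using c\<^sub>1 by (simp add: field_simps)
      qed
      have "(\<Sum>z\<in>N - {y}. ?w {y, z}) \<le> (\<Sum>z\<in>N - {y}. (2 * c\<^sub>2) powr \<alpha> * dist (x i) (x z) powr \<alpha>)"
      proof (rule sum_mono)
        fix z assume z: "z \<in> N - {y}"
        then have zS: "x z \<in> S" and yS: "x y \<in> S" using NS y by auto
        have "h (x y) (x z) \<le> c\<^sub>2 * dist (x y) (x z)" using h[OF yS zS] by simp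
        \<comment> \<open>Here the centre \<open>y\<close> has to be a neighbour nearest to \<open>x i\<close>.\<close>
        also have "\<dots> \<le> c\<^sub>2 * (2 * dist (x i) (x z))"
          using dist_triangle3[of "x y" "x z" "x i"] y(2)[of z] z c\<^sub>2 by (intro mult_left_mono) auto
        finally have "min (h (x y) (x z)) r \<le> 2 * c\<^sub>2 * dist (x i) (x z)" by simp
        then have "min (h (x y) (x z)) r powr \<alpha> \<le> (2 * c\<^sub>2 * dist (x i) (x z)) powr \<alpha>"
          using h[OF yS zS] r \<alpha> by (intro powr_mono2) auto
        also have "\<dots> = (2 * c\<^sub>2) powr \<alpha> * dist (x i) (x z) powr \<alpha>" by (rule powr_mult)
        finally show "?w {y, z} \<le> (2 * c\<^sub>2) powr \<alpha> * dist (x i) (x z) powr \<alpha>"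
          by (simp add: truncated_weight_pair yS zS)
      qed
      also have "\<dots> = (2 * c\<^sub>2) powr \<alpha> * (\<Sum>z\<in>N - {y}. dist (x i) (x z) powr \<alpha>)"
        by (rule sum_distrib_left[symmetric])
      also have "\<dots> \<le> (2 * c\<^sub>2) powr \<alpha> * (K * (r / c\<^sub>1) powr \<alpha>)"
      proof (intro mult_left_mono star)
        fix j assume "j \<in> N - {y}"
        then show "dist (x i) (x j) \<le> r / c\<^sub>1" using far[of j y] y(1) by auto
      next
        fix j k assume jk: "j \<in> N - {y}" "k \<in> N - {y}" "j \<noteq> k"
        then have "c\<^sub>1 * dist (x i) (x j) \<le> c\<^sub>2 * dist (x k) (x j)"
          using cmp[of k j] h[OF iS NS[of j]] h[OF NS[of k] NS[of j]] by auto
        then show "c\<^sub>1 / c\<^sub>2 * dist (x i) (x j) \<le> dist (x j) (x k)"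
          using c\<^sub>2 by (simp add: field_simps dist_commute)
      qed (use finN r c\<^sub>1 in auto)
      also have "\<dots> = C * r powr \<alpha>"
        using r c\<^sub>1 c\<^sub>2 by (simp add: C_def powr_divide powr_mult)
      finally show "\<exists>y\<in>N. (\<Sum>z\<in>N - {y}. ?w {y, z}) \<le> C * r powr \<alpha>" using y(1) by blast
    qed
  qed
qed

text \<open>
  Moving the point \<open>i\<close> means removing it and adding it again elsewhere.
\<close>
lemma truncated_MST_bounded_differences:
  obtains K where "0 < K" "\<And>n x i y r. (\<And>j. j \<in> {1..n} \<Longrightarrow> x j \<in> S) \<Longrightarrow> i \<in> {1..n} \<Longrightarrow> y \<in> S \<Longrightarrow> 0 \<le> r \<Longrightarrow>
    \<bar>MST (truncated h r) \<alpha> (x(i := y)) n - MST (truncated h r) \<alpha> x n\<bar> \<le> K * r powr \<alpha>"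
proof -
  obtain K where K: "0 \<le> K" and remove: "\<And>(V :: nat set) i x r.
    finite V \<Longrightarrow> i \<notin> V \<Longrightarrow> (\<And>j. j \<in> insert i V \<Longrightarrow> x j \<in> S) \<Longrightarrow> 0 \<le> r \<Longrightarrow>
    connection_cost (edge_weight (truncated h r) \<alpha> x) V \<le>
    connection_cost (edge_weight (truncated h r) \<alpha> x) (insert i V) + K * r powr \<alpha>"
    using removal_cost by metis
  have le: "MST (truncated h r) \<alpha> x' n \<le> MST (truncated h r) \<alpha> x n + (K + 1) * r powr \<alpha>"
    if x: "\<And>j. j \<in> {1..n} \<Longrightarrow> x j \<in> S" "\<And>j. j \<in> {1..n} \<Longrightarrow> x' j \<in> S"
      and i: "i \<in> {1..n}" and eq: "\<And>j. j \<noteq> i \<Longrightarrow> x' j = x j" and r: "0 \<le> r" for x x' n i r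
  proof -
    define V where "V = {1..n} - {i}"
    have V: "{1..n} = insert i V" "finite V" "i \<notin> V" using i by (auto simp: V_def)
    let ?w = "edge_weight (truncated h r) \<alpha> x" and ?w' = "edge_weight (truncated h r) \<alpha> x'"
    have "connection_cost ?w' (insert i V) \<le> connection_cost ?w' V + r powr \<alpha>"
    proof (cases "V = {}")
      case True
      then show ?thesis by (simp add: connection_cost_singleton connection_cost_empty)
    next
      case False
      then obtain v where v: "v \<in> V" by auto
      have "v \<in> {1..n}" using v unfolding V(1) by simp
      with i have S: "x' i \<in> S" "x' v \<in> S" by (auto intro!: x(2))
      have "?w' {i, v} \<le> r powr \<alpha>"
        unfolding truncated_weight_pair[OF S] using h[OF S] r \<alpha> by (intro powr_mono2) auto
      moreover have "connection_cost ?w' (insert i V) \<le> connection_cost ?w' V + ?w' {i, v}"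
        using V v by (intro connection_cost_insert_le) (auto simp: edge_weight_def)
      ultimately show ?thesis by simp
    qed
    also have "connection_cost ?w' V = connection_cost ?w V"
    proof (rule connection_cost_cong[OF V(2)])
      fix e assume "e \<in> complete_edges V"
      then obtain u v where "e = {u, v}" "u \<in> V" "v \<in> V" by (rule complete_edgesE)
      then show "?w' e = ?w e" using V(3) by (intro edge_weight_cong) (auto intro!: eq)
    qed
    also have "connection_cost ?w V \<le> connection_cost ?w (insert i V) + K * r powr \<alpha>"
      using V x(1) r by (intro remove) auto
    finally show ?thesis unfolding MST_eq_connection_cost V(1) by (simp add: algebra_simps)
  qed
  show ?thesis
  proof (rule that[of "K + 1"])
    fix n i :: nat and x :: "nat \<Rightarrow> real^2" and y :: "real^2" and r :: real
    assume a: "\<And>j. j \<in> {1..n} \<Longrightarrow> x j \<in> S" "i \<in> {1..n}" "y \<in> S" "0 \<le> r"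
    have "MST (truncated h r) \<alpha> (x(i := y)) n \<le> MST (truncated h r) \<alpha> x n + (K + 1) * r powr \<alpha>"
      by (rule le[of n x "x(i := y)" i]) (use a in auto)
    moreover have "MST (truncated h r) \<alpha> x n \<le> MST (truncated h r) \<alpha> (x(i := y)) n + (K + 1) * r powr \<alpha>"
      by (rule le[of n "x(i := y)" x i]) (use a in auto)
    ultimately show "\<bar>MST (truncated h r) \<alpha> (x(i := y)) n - MST (truncated h r) \<alpha> x n\<bar> \<le> (K + 1) * r powr \<alpha>"
      by simp
  qed (use K in simp)
qed

lemma MST_truncated_eq:
  assumes x: "\<And>j. j \<in> {1..n} \<Longrightarrow> x j \<in> S" and r: "0 \<le> r"
    and cut: "\<And>A. A \<subseteq> {1..n} \<Longrightarrow> A \<noteq> {} \<Longrightarrow> A \<noteq> {1..n} \<Longrightarrow>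
      \<exists>u\<in>A. \<exists>v\<in>{1..n} - A. h (x u) (x v) \<le> r"
  shows "MST (truncated h r) \<alpha> x n = MST h \<alpha> x n"
proof -
  let ?w = "edge_weight h \<alpha> x"
  have pair: "?w {u, v} = h (x u) (x v) powr \<alpha>" if "u \<in> {1..n}" "v \<in> {1..n}" for u v
    using h[OF x[OF that(1)] x[OF that(2)]] by (intro edge_weight_pair) auto
  have "connection_cost (edge_weight (truncated h r) \<alpha> x) {1..n} =
      connection_cost (\<lambda>e. min (?w e) (r powr \<alpha>)) {1..n}"
  proof (rule connection_cost_cong)
    fix e assume "e \<in> complete_edges {1..n}"
    then obtain u v where e: "e = {u, v}" "u \<in> {1..n}" "v \<in> {1..n}" by (rule complete_edgesE)
    then have S: "x u \<in> S" "x v \<in> S" using x by auto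
    show "edge_weight (truncated h r) \<alpha> x e = min (?w e) (r powr \<alpha>)"
      unfolding e(1) truncated_weight_pair[OF S] pair[OF e(2,3)]
      using h[OF S] r \<alpha> by (intro min_powr) auto
  qed simp
  also have "\<dots> = connection_cost ?w {1..n}"
  proof (rule connection_cost_truncated)
    fix A assume A: "A \<subseteq> {1..n}" "A \<noteq> {}" "A \<noteq> {1..n}"
    then obtain u v where uv: "u \<in> A" "v \<in> {1..n} - A" "h (x u) (x v) \<le> r" using cut by blast
    then have u: "u \<in> {1..n}" "v \<in> {1..n}" using A by auto
    have "?w {u, v} \<le> r powr \<alpha>"
      unfolding pair[OF u] using uv h[OF x[OF u(1)] x[OF u(2)]] \<alpha> by (intro powr_mono2) auto
    then show "\<exists>u\<in>A. \<exists>v\<in>{1..n} - A. ?w {u, v} \<le> r powr \<alpha>" using uv by blast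
  qed auto
  finally show ?thesis by (simp add: MST_eq_connection_cost)
qed

end

lemma card_complete_edges_le: "finite V \<Longrightarrow> card (complete_edges V) \<le> (card V)\<^sup>2"
proof -
  assume V: "finite V"
  have "complete_edges V \<subseteq> (\<lambda>(u, v). {u, v}) ` (V \<times> V)" by (auto simp: complete_edges_def)
  then have "card (complete_edges V) \<le> card (V \<times> V)"
    using V by (intro surj_card_le) auto
  then show ?thesis by (simp add: card_cartesian_product power2_eq_square)
qed

lemma MST_nonneg: "0 \<le> MST h \<alpha> x n"
  unfolding MST_eq_connection_cost by (rule connection_cost_nonneg) (auto simp: edge_weight_def)

text \<open>
  A crude bound, for integrability and for the rare event that the truncation has an effect: that
  event is superpolynomially rare, so that the power of \<open>n\<close> is immaterial.
\<close>
lemma MST_le: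
  assumes "\<And>i j. i \<in> {1..n} \<Longrightarrow> j \<in> {1..n} \<Longrightarrow> h (x i) (x j) powr \<alpha> \<le> C"
  shows "MST h \<alpha> x n \<le> (real n)\<^sup>2 * C"
proof (cases "n = 0")
  case True
  then show ?thesis by (simp add: MST_eq_connection_cost connection_cost_empty)
next
  case False
  have "0 \<le> h (x 1) (x 1) powr \<alpha>" by simp
  also have "\<dots> \<le> C" using False assms by simp
  finally have C: "0 \<le> C" .
  let ?E = "complete_edges {1..n}"
  have "MST h \<alpha> x n \<le> sum (edge_weight h \<alpha> x) ?E"
    unfolding MST_eq_connection_cost by (intro connection_cost_le complete_edges_connected) simp
  also have "\<dots> \<le> (\<Sum>e\<in>?E. C)"
  proof (rule sum_mono)
    fix e assume "e \<in> ?E"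
    then obtain u v where e: "e = {u, v}" "u \<in> {1..n}" "v \<in> {1..n}" by (rule complete_edgesE)
    then have "Min e \<in> {1..n}" "Max e \<in> {1..n}" by (auto simp: min_def max_def)
    then show "edge_weight h \<alpha> x e \<le> C" unfolding edge_weight_def by (rule assms)
  qed
  also have "\<dots> = real (card ?E) * C" by simp
  also have "\<dots> \<le> (real n)\<^sup>2 * C"
    using C card_complete_edges_le[of "{1..n}"] by (intro mult_right_mono) (auto simp flip: of_nat_power)
  finally show ?thesis .
qed

section \<open>Random points\<close>

lemma MST_cong:
  assumes "\<And>i. i \<in> {1..n} \<Longrightarrow> x i = y i"
  shows "MST h \<alpha> x n = MST h \<alpha> y n"
  unfolding MST_eq_connection_cost
proof (rule connection_cost_cong)
  fix e assume "e \<in> complete_edges {1..n}"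
  then obtain u v where "e = {u, v}" "u \<in> {1..n}" "v \<in> {1..n}" by (rule complete_edgesE)
  then show "edge_weight h \<alpha> x e = edge_weight h \<alpha> y e"
    by (intro edge_weight_cong) (auto intro!: assms)
qed simp

lemma measurable_MST:
  fixes S :: "(real^2) set"
  assumes h: "(\<lambda>(x, y). h x y) \<in> borel_measurable (restrict_space borel (S \<times> S))"
  shows "(\<lambda>x. MST h \<alpha> x n) \<in> borel_measurable (\<Pi>\<^sub>M i\<in>{1..n}. restrict_space borel S)"
proof -
  let ?P = "\<Pi>\<^sub>M i\<in>{1..n}. restrict_space borel S"
  have incl: "(\<lambda>p. p) \<in> borel_measurable (restrict_space borel S)"
    by (intro measurable_restrict_space1) simp
  have comp: "(\<lambda>x. x i) \<in> borel_measurable ?P" if "i \<in> {1..n}" for i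
  proof -
    have "(\<lambda>x. x i) \<in> measurable ?P (restrict_space borel S)"
      using that by (rule measurable_component_singleton)
    from measurable_compose[OF this incl] show ?thesis .
  qed
  have hij: "(\<lambda>x. h (x i) (x j)) \<in> borel_measurable ?P" if "i \<in> {1..n}" "j \<in> {1..n}" for i j
  proof -
    have "(\<lambda>x. (x i, x j)) \<in> measurable ?P (restrict_space borel (S \<times> S))"
    proof (rule measurable_restrict_space2)
      show "(\<lambda>x. (x i, x j)) \<in> space ?P \<rightarrow> S \<times> S"
      proof
        fix x assume "x \<in> space ?P"
        then have x: "x \<in> (\<Pi>\<^sub>E i\<in>{1..n}. S)" by (simp add: space_PiM space_restrict_space)
        from PiE_mem[OF x that(1)] PiE_mem[OF x that(2)] show "(x i, x j) \<in> S \<times> S" by simp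
      qed
      show "(\<lambda>x. (x i, x j)) \<in> borel_measurable ?P"
        using comp that by (intro borel_measurable_Pair) auto
    qed
    from measurable_compose[OF this h] show ?thesis by simp
  qed
  have "(\<lambda>x. edge_weight h \<alpha> x e) \<in> borel_measurable ?P" if e: "e \<in> complete_edges {1..n}" for e
  proof -
    obtain u v where "e = {u, v}" "u \<in> {1..n}" "v \<in> {1..n}" by (rule complete_edgesE[OF e])
    then have "Min e \<in> {1..n}" "Max e \<in> {1..n}" by (auto simp: min_def max_def)
    then show ?thesis unfolding edge_weight_def using hij by (intro powr_real_measurable) auto
  qed
  then show ?thesis
    unfolding MST_eq_connection_cost connection_cost_def
    by (intro borel_measurable_Min borel_measurable_sum)
       (auto simp: finite_connected_edge_sets, auto simp: connected_edge_sets_def)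
qed

text \<open>
  The lower bound \<open>\<epsilon>\<close> of the density is what makes empty cells rare.
\<close>
locale random_points = prob_space M + distance_like unit_square h c\<^sub>1 c\<^sub>2 \<alpha>
  for M :: "'a measure" and h c\<^sub>1 c\<^sub>2 \<alpha> +
  fixes X :: "nat \<Rightarrow> 'a \<Rightarrow> real^2" and f :: "real^2 \<Rightarrow> real" and \<epsilon> :: real
  assumes \<epsilon>: "0 < \<epsilon>" and f_lower: "\<And>x. x \<in> unit_square \<Longrightarrow> \<epsilon> \<le> f x"
    and X_distr: "\<And>i. i \<ge> 1 \<Longrightarrow>
      distributed M (restrict_space lborel unit_square) (X i) (\<lambda>x. ennreal (f x))"
    and X_indep: "indep_vars (\<lambda>_. restrict_space borel unit_square) X {1..}"
    and h_measurable: "(\<lambda>(x, y). h x y) \<in> borel_measurable (restrict_space borel (unit_square \<times> unit_square))"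
begin

abbreviation Sq :: "(real^2) measure" where "Sq \<equiv> restrict_space borel unit_square"

lemma X_measurable: "i \<ge> 1 \<Longrightarrow> X i \<in> measurable M Sq"
  using X_indep by (auto simp: indep_vars_def)

lemma X_in_square: "i \<ge> 1 \<Longrightarrow> \<omega> \<in> space M \<Longrightarrow> X i \<omega> \<in> unit_square"
  using measurable_space[OF X_measurable] by (simp add: space_restrict_space)

lemma truncated_measurable:
  "(\<lambda>(x, y). truncated h r x y) \<in> borel_measurable (restrict_space borel (unit_square \<times> unit_square))"
proof -
  have "(\<lambda>p. min ((\<lambda>(x, y). h x y) p) r) \<in> borel_measurable (restrict_space borel (unit_square \<times> unit_square))"
    using h_measurable by (intro borel_measurable_min) auto
  then show ?thesis by (simp add: case_prod_beta')
qed

lemma X_tuple_measurable: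
  "(\<lambda>\<omega>. \<lambda>i\<in>{1..n}. X i \<omega>) \<in> measurable M (\<Pi>\<^sub>M i\<in>{1..n}. Sq)"
  by (intro measurable_restrict X_measurable) auto

lemma MST_random_measurable:
  assumes "(\<lambda>(x, y). g x y) \<in> borel_measurable (restrict_space borel (unit_square \<times> unit_square))"
  shows "(\<lambda>\<omega>. MST g \<alpha> (\<lambda>i. X i \<omega>) n) \<in> borel_measurable M"
proof -
  have "(\<lambda>\<omega>. MST g \<alpha> (\<lambda>i\<in>{1..n}. X i \<omega>) n) \<in> borel_measurable M"
    using measurable_compose[OF X_tuple_measurable measurable_MST[OF assms]] .
  moreover have "MST g \<alpha> (\<lambda>i\<in>{1..n}. X i \<omega>) n = MST g \<alpha> (\<lambda>i. X i \<omega>) n" for \<omega>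
    by (rule MST_cong) simp
  ultimately show ?thesis by simp
qed

lemma h_powr_le:
  assumes "x \<in> unit_square" "y \<in> unit_square"
  shows "h x y powr \<alpha> \<le> (2 * c\<^sub>2) powr \<alpha>"
proof -
  have "\<bar>(x - y) $ i\<bar> \<le> 1" for i
    using assms by (auto simp: unit_square_def mem_box_cart abs_le_iff dest!: spec[of _ i])
  then have "(\<Sum>i\<in>UNIV. \<bar>(x - y) $ i\<bar>) \<le> (\<Sum>i\<in>(UNIV :: 2 set). 1)" by (intro sum_mono) auto
  then have "dist x y \<le> 2" using norm_le_l1_cart[of "x - y"] by (simp add: dist_norm)
  then have "c\<^sub>2 * dist x y \<le> c\<^sub>2 * 2" using c\<^sub>2 by (intro mult_left_mono) auto
  then show ?thesis using h[OF assms] \<alpha> by (intro powr_mono2) auto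
qed

lemma MST_bounded:
  assumes "\<And>i. i \<in> {1..n} \<Longrightarrow> x i \<in> unit_square"
  shows "\<bar>MST h \<alpha> x n\<bar> \<le> (real n)\<^sup>2 * (2 * c\<^sub>2) powr \<alpha>"
    and "0 \<le> r \<Longrightarrow> \<bar>MST (truncated h r) \<alpha> x n\<bar> \<le> (real n)\<^sup>2 * (2 * c\<^sub>2) powr \<alpha>"
proof -
  show "\<bar>MST h \<alpha> x n\<bar> \<le> (real n)\<^sup>2 * (2 * c\<^sub>2) powr \<alpha>"
    using MST_le[of n h x \<alpha> "(2 * c\<^sub>2) powr \<alpha>"] h_powr_le assms MST_nonneg[of h \<alpha> x n] by auto
  assume r: "0 \<le> r"
  have "truncated h r (x i) (x j) powr \<alpha> \<le> (2 * c\<^sub>2) powr \<alpha>" if "i \<in> {1..n}" "j \<in> {1..n}" for i j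
  proof -
    have S: "x i \<in> unit_square" "x j \<in> unit_square" using assms that by auto
    have "truncated h r (x i) (x j) powr \<alpha> \<le> h (x i) (x j) powr \<alpha>"
      using h[OF S] r \<alpha> by (intro powr_mono2) auto
    with h_powr_le[OF S] show ?thesis by simp
  qed
  then show "\<bar>MST (truncated h r) \<alpha> x n\<bar> \<le> (real n)\<^sup>2 * (2 * c\<^sub>2) powr \<alpha>"
    using MST_le[of n "truncated h r" x \<alpha> "(2 * c\<^sub>2) powr \<alpha>"] MST_nonneg[of "truncated h r" \<alpha> x n] by auto
qed

text \<open>
  The constant \<open>K\<close> is uniform in \<open>n\<close> and \<open>r\<close>, so that the cut-off level may depend on \<open>n\<close> later.
\<close>
lemma truncated_MST_concentration:
  "\<exists>K>0. \<forall>n\<ge>1. \<forall>r\<ge>0. \<forall>B>0. \<forall>t>0. K * r powr \<alpha> \<le> B \<longrightarrow>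
    prob {\<omega> \<in> space M. t \<le> \<bar>MST (truncated h r) \<alpha> (\<lambda>i. X i \<omega>) n
        - expectation (\<lambda>\<omega>'. MST (truncated h r) \<alpha> (\<lambda>i. X i \<omega>') n)\<bar>}
      \<le> 2 * exp (- t\<^sup>2 / (2 * real n * B\<^sup>2))"
proof -
  obtain K where K: "0 < K" and diff: "\<And>n x i y r. (\<And>j. j \<in> {1..n} \<Longrightarrow> x j \<in> unit_square) \<Longrightarrow>
    i \<in> {1..n} \<Longrightarrow> y \<in> unit_square \<Longrightarrow> 0 \<le> r \<Longrightarrow>
    \<bar>MST (truncated h r) \<alpha> (x(i := y)) n - MST (truncated h r) \<alpha> x n\<bar> \<le> K * r powr \<alpha>"
    using truncated_MST_bounded_differences by metis
  \<comment> \<open>The hypotheses concern the indices from \<open>1\<close> on, a product space needs a measure for every index.\<close>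
  define D where "D i = distr M Sq (X (max 1 i))" for i :: nat
  have prob_D: "prob_space (D i)" for i
    unfolding D_def by (intro prob_space_distr X_measurable) simp
  interpret D: product_prob_space D
    by (simp add: product_prob_space_def product_prob_space_axioms_def product_sigma_finite_def
        prob_D prob_space_imp_sigma_finite)
  have sets_D: "sets (Pi\<^sub>M J D) = sets (\<Pi>\<^sub>M i\<in>J. Sq)" for J
    by (intro sets_PiM_cong) (auto simp: D_def)
  have space_D: "space (D i) = unit_square" for i by (simp add: D_def space_restrict_space)
  show ?thesis
  proof (intro exI[of _ K] conjI allI impI K)
    fix n :: nat and r B t :: real
    assume n: "1 \<le> n" and r: "0 \<le> r" and B0: "0 < B" and t: "0 < t" and KB: "K * r powr \<alpha> \<le> B"
    note B = KB B0
    let ?I = "{1..n}" and ?X = "\<lambda>\<omega>. \<lambda>i\<in>{1..n}. X i \<omega>"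
    define F where "F x = MST (truncated h r) \<alpha> x n" for x
    have F_meas: "F \<in> borel_measurable (Pi\<^sub>M ?I D)"
      unfolding F_def measurable_cong_sets[OF sets_D refl]
      by (rule measurable_MST[OF truncated_measurable])
    have in_sq: "x j \<in> unit_square" if "x \<in> space (Pi\<^sub>M ?I D)" "j \<in> ?I" for x j
    proof -
      from that(1) have "x \<in> (\<Pi>\<^sub>E i\<in>?I. unit_square)" by (simp add: space_PiM space_D)
      from PiE_mem[OF this that(2)] show ?thesis .
    qed
    have tail: "measure (Pi\<^sub>M ?I D) {x \<in> space (Pi\<^sub>M ?I D). t \<le> \<bar>F x - integral\<^sup>L (Pi\<^sub>M ?I D) F\<bar>}
        \<le> 2 * exp (- t\<^sup>2 / (2 * real (card ?I) * B\<^sup>2))"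
    proof (rule D.bounded_differences_tail[OF _ _ F_meas])
      show "\<bar>F x\<bar> \<le> (real n)\<^sup>2 * (2 * c\<^sub>2) powr \<alpha>" if "x \<in> space (Pi\<^sub>M ?I D)" for x
        unfolding F_def using in_sq[OF that] r by (intro MST_bounded) auto
      show "\<bar>F (x(i := y)) - F x\<bar> \<le> B"
        if "x \<in> space (Pi\<^sub>M ?I D)" "i \<in> ?I" "y \<in> space (D i)" for x i y
      proof -
        have "\<bar>F (x(i := y)) - F x\<bar> \<le> K * r powr \<alpha>"
          unfolding F_def using that in_sq[OF that(1)] r by (intro diff) (auto simp: space_D)
        with B(1) show ?thesis by simp
      qed
    qed (use n t B in auto)
    have distr: "distr M (\<Pi>\<^sub>M i\<in>?I. Sq) ?X = Pi\<^sub>M ?I D"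
    proof -
      have "indep_vars (\<lambda>_. Sq) X ?I" using X_indep by (rule indep_vars_subset) auto
      then have "distr M (\<Pi>\<^sub>M i\<in>?I. Sq) ?X = (\<Pi>\<^sub>M i\<in>?I. distr M Sq (X i))"
        using n by (subst (asm) indep_vars_iff_distr_eq_PiM') (auto intro: X_measurable)
      also have "\<dots> = Pi\<^sub>M ?I D" by (intro PiM_cong) (auto simp: D_def max_def)
      finally show ?thesis .
    qed
    have F_meas': "F \<in> borel_measurable (\<Pi>\<^sub>M i\<in>?I. Sq)"
      using F_meas unfolding measurable_cong_sets[OF sets_D refl] .
    have FX: "F (?X \<omega>) = F (\<lambda>i. X i \<omega>)" for \<omega>
      unfolding F_def by (rule MST_cong) simp
    have E: "integral\<^sup>L (Pi\<^sub>M ?I D) F = expectation (\<lambda>\<omega>. F (\<lambda>i. X i \<omega>))"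
      unfolding distr[symmetric] by (subst integral_distr[OF X_tuple_measurable F_meas']) (simp only: FX)
    define m where "m = expectation (\<lambda>\<omega>. F (\<lambda>i. X i \<omega>))"
    have set_meas: "{x \<in> space (\<Pi>\<^sub>M i\<in>?I. Sq). t \<le> \<bar>F x - m\<bar>} \<in> sets (\<Pi>\<^sub>M i\<in>?I. Sq)"
      using F_meas' by measurable
    have spaces: "space (Pi\<^sub>M ?I D) = space (\<Pi>\<^sub>M i\<in>?I. Sq)" by (rule sets_eq_imp_space_eq[OF sets_D])
    have "measure (Pi\<^sub>M ?I D) {x \<in> space (Pi\<^sub>M ?I D). t \<le> \<bar>F x - m\<bar>} =
        prob (?X -` {x \<in> space (\<Pi>\<^sub>M i\<in>?I. Sq). t \<le> \<bar>F x - m\<bar>} \<inter> space M)"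
      unfolding spaces unfolding distr[symmetric]
      by (rule measure_distr[OF X_tuple_measurable set_meas])
    also have "?X -` {x \<in> space (\<Pi>\<^sub>M i\<in>?I. Sq). t \<le> \<bar>F x - m\<bar>} \<inter> space M =
        {\<omega> \<in> space M. t \<le> \<bar>F (\<lambda>i. X i \<omega>) - m\<bar>}"
      using measurable_space[OF X_tuple_measurable[of n]] unfolding vimage_def
      by (auto simp only: FX mem_Collect_eq Int_iff)
    finally have "prob {\<omega> \<in> space M. t \<le> \<bar>F (\<lambda>i. X i \<omega>) - m\<bar>} \<le> 2 * exp (- t\<^sup>2 / (2 * real n * B\<^sup>2))"
      using tail unfolding E m_def[symmetric] by simp
    then show "prob {\<omega> \<in> space M. t \<le> \<bar>MST (truncated h r) \<alpha> (\<lambda>i. X i \<omega>) n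
        - expectation (\<lambda>\<omega>'. MST (truncated h r) \<alpha> (\<lambda>i. X i \<omega>') n)\<bar>}
      \<le> 2 * exp (- t\<^sup>2 / (2 * real n * B\<^sup>2))"
      unfolding F_def m_def .
  qed
qed

definition empty_cell_event :: "nat \<Rightarrow> nat \<Rightarrow> 'a set" where
  "empty_cell_event m n = (\<Union>k\<in>grid_indices m. {\<omega> \<in> space M. \<forall>i\<in>{1..n}. X i \<omega> \<notin> grid_cell m k})"

lemma prob_avoids_cell:
  assumes "0 < m" "k \<in> grid_indices m" "1 \<le> i"
  shows "prob (X i -` (unit_square - grid_cell m k) \<inter> space M) \<le> exp (- \<epsilon> / (real m)\<^sup>2)"
proof -
  let ?C = "grid_cell m k" and ?N = "restrict_space lborel unit_square"
  have C: "?C \<subseteq> unit_square" using assms(2) by (rule grid_cell_subset)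
  have C_borel: "?C \<in> sets borel" by (simp add: grid_cell_def)
  have CN: "?C \<in> sets ?N"
    using C C_borel by (simp add: sets_restrict_space_iff unit_square_def)
  have Xi: "X i \<in> measurable M Sq" using X_measurable assms(3) by simp
  have CS: "?C \<in> sets Sq" using CN by (simp add: sets_restrict_space cong: sets_restrict_space_cong)
  have "ennreal (\<epsilon> / (real m)\<^sup>2) = ennreal \<epsilon> * emeasure lborel ?C"
  proof -
    have "emeasure lborel ?C \<noteq> \<infinity>"
      using emeasure_lborel_cbox_finite by (simp add: grid_cell_def less_top[symmetric])
    then have "emeasure lborel ?C = ennreal (1 / (real m)\<^sup>2)"
      using measure_grid_cell[OF assms(1), of k] by (simp add: emeasure_eq_ennreal_measure)
    then show ?thesis using \<epsilon> by (simp flip: ennreal_mult)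
  qed
  also have "\<dots> = ennreal \<epsilon> * emeasure ?N ?C"
    using C by (simp add: emeasure_restrict_space unit_square_def)
  also have "\<dots> = (\<integral>\<^sup>+x. ennreal \<epsilon> * indicator ?C x \<partial>?N)"
    using CN by (simp add: nn_integral_cmult_indicator)
  also have "\<dots> \<le> (\<integral>\<^sup>+x. ennreal (f x) * indicator ?C x \<partial>?N)"
    by (intro nn_integral_mono mult_right_mono ennreal_leI f_lower) (auto simp: space_restrict_space)
  also have "\<dots> = emeasure M (X i -` ?C \<inter> space M)"
    using distributed_emeasure[OF X_distr[OF assms(3)] CN] by simp
  finally have "\<epsilon> / (real m)\<^sup>2 \<le> prob (X i -` ?C \<inter> space M)"
    by (simp add: emeasure_eq_measure)
  moreover have "X i -` (unit_square - ?C) \<inter> space M = space M - (X i -` ?C \<inter> space M)"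
    using X_in_square[OF assms(3)] by auto
  moreover have "prob (space M - (X i -` ?C \<inter> space M)) = 1 - prob (X i -` ?C \<inter> space M)"
    by (intro prob_compl measurable_sets[OF Xi CS])
  moreover have "1 - \<epsilon> / (real m)\<^sup>2 \<le> exp (- \<epsilon> / (real m)\<^sup>2)"
    using exp_ge_add_one_self[of "- \<epsilon> / (real m)\<^sup>2"] by simp
  ultimately show ?thesis by simp
qed

lemma empty_cell_event:
  assumes m: "0 < m" and n: "1 \<le> n"
  shows "empty_cell_event m n \<in> events"
    and "prob (empty_cell_event m n) \<le> (real m)\<^sup>2 * exp (- \<epsilon> * real n / (real m)\<^sup>2)"
proof -
  let ?A = "\<lambda>k. {\<omega> \<in> space M. \<forall>i\<in>{1..n}. X i \<omega> \<notin> grid_cell m k}"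
  let ?V = "\<lambda>k i. X i -` (unit_square - grid_cell m k) \<inter> space M"
  have A_eq: "?A k = (\<Inter>i\<in>{1..n}. ?V k i)" for k
    using n X_in_square by fastforce
  have diff: "unit_square - grid_cell m k \<in> sets Sq" for k
    by (auto simp: sets_restrict_space_iff unit_square_def grid_cell_def)
  have V: "?V k i \<in> events" if "1 \<le> i" for k i
    using measurable_sets[OF X_measurable[OF that] diff] .
  have A: "?A k \<in> events" for k
    unfolding A_eq using n V by (intro sets.finite_INT) auto
  show "empty_cell_event m n \<in> events"
    unfolding empty_cell_event_def using A finite_grid_indices by (intro sets.finite_UN) auto
  have A_prob: "prob (?A k) \<le> exp (- \<epsilon> * real n / (real m)\<^sup>2)" if k: "k \<in> grid_indices m" for k
  proof -
    have "prob (?A k) = (\<Prod>i\<in>{1..n}. prob (?V k i))"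
      unfolding A_eq using n diff by (intro indep_varsD[OF X_indep]) auto
    also have "\<dots> \<le> (\<Prod>i\<in>{1..n}. exp (- \<epsilon> / (real m)\<^sup>2))"
      using prob_avoids_cell[OF m k] by (intro prod_mono) auto
    also have "\<dots> = exp (- \<epsilon> * real n / (real m)\<^sup>2)"
      by (simp add: exp_of_nat_mult[symmetric] algebra_simps)
    finally show ?thesis .
  qed
  have "prob (empty_cell_event m n) \<le> (\<Sum>k\<in>grid_indices m. prob (?A k))"
    unfolding empty_cell_event_def using A finite_grid_indices
    by (intro finite_measure_subadditive_finite) auto
  also have "\<dots> \<le> (\<Sum>k\<in>grid_indices m. exp (- \<epsilon> * real n / (real m)\<^sup>2))"
    by (intro sum_mono A_prob)
  also have "\<dots> = (real m)\<^sup>2 * exp (- \<epsilon> * real n / (real m)\<^sup>2)"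
    by (simp add: card_grid_indices)
  finally show "prob (empty_cell_event m n) \<le> (real m)\<^sup>2 * exp (- \<epsilon> * real n / (real m)\<^sup>2)" .
qed

lemma MST_truncated_eq_outside:
  assumes m: "0 < m" and \<omega>: "\<omega> \<in> space M" "\<omega> \<notin> empty_cell_event m n"
  shows "MST (truncated h (4 * c\<^sub>2 / real m)) \<alpha> (\<lambda>i. X i \<omega>) n = MST h \<alpha> (\<lambda>i. X i \<omega>) n"
proof (rule MST_truncated_eq)
  show sq: "X j \<omega> \<in> unit_square" if "j \<in> {1..n}" for j using that X_in_square \<omega> by auto
  show "0 \<le> 4 * c\<^sub>2 / real m" using c\<^sub>2 by simp
  fix A assume A: "A \<subseteq> {1..n}" "A \<noteq> {}" "A \<noteq> {1..n}"
  have "\<exists>u\<in>A. \<exists>v\<in>{1..n} - A. dist (X u \<omega>) (X v \<omega>) \<le> 4 / real m"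
    by (rule occupied_cells_cut[OF m _ sq _ A]) (use \<omega> in \<open>auto simp: empty_cell_event_def\<close>)
  then obtain u v where uv: "u \<in> A" "v \<in> {1..n} - A" "dist (X u \<omega>) (X v \<omega>) \<le> 4 / real m" by blast
  have "h (X u \<omega>) (X v \<omega>) \<le> c\<^sub>2 * dist (X u \<omega>) (X v \<omega>)" using h sq uv A by blast
  also have "\<dots> \<le> c\<^sub>2 * (4 / real m)" using uv c\<^sub>2 by (intro mult_left_mono) auto
  finally have "h (X u \<omega>) (X v \<omega>) \<le> 4 * c\<^sub>2 / real m" by (simp add: mult.commute)
  with uv(1,2) show "\<exists>u\<in>A. \<exists>v\<in>{1..n} - A. h (X u \<omega>) (X v \<omega>) \<le> 4 * c\<^sub>2 / real m"
    by blast
qed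

lemma expectation_truncated_diff:
  assumes m: "0 < m" and n: "1 \<le> n"
  shows "\<bar>expectation (\<lambda>\<omega>. MST (truncated h (4 * c\<^sub>2 / real m)) \<alpha> (\<lambda>i. X i \<omega>) n)
      - expectation (\<lambda>\<omega>. MST h \<alpha> (\<lambda>i. X i \<omega>) n)\<bar>
    \<le> 2 * (real n)\<^sup>2 * (2 * c\<^sub>2) powr \<alpha> * prob (empty_cell_event m n)"
proof -
  let ?F = "\<lambda>\<omega>. MST h \<alpha> (\<lambda>i. X i \<omega>) n"
  let ?G = "\<lambda>\<omega>. MST (truncated h (4 * c\<^sub>2 / real m)) \<alpha> (\<lambda>i. X i \<omega>) n"
  let ?C = "(real n)\<^sup>2 * (2 * c\<^sub>2) powr \<alpha>" and ?bad = "empty_cell_event m n"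
  have F: "\<bar>?F \<omega>\<bar> \<le> ?C" and G: "\<bar>?G \<omega>\<bar> \<le> ?C" if "\<omega> \<in> space M" for \<omega>
    using X_in_square that c\<^sub>2 by (auto intro!: MST_bounded)
  have intF: "integrable M ?F" and intG: "integrable M ?G"
    using F G MST_random_measurable[OF h_measurable] MST_random_measurable[OF truncated_measurable]
    by (auto intro!: integrable_const_bound[of _ ?C] AE_I2)
  have "\<bar>expectation ?G - expectation ?F\<bar> = \<bar>expectation (\<lambda>\<omega>. ?G \<omega> - ?F \<omega>)\<bar>"
    using intF intG by simp
  also have "\<dots> \<le> expectation (\<lambda>\<omega>. \<bar>?G \<omega> - ?F \<omega>\<bar>)" by (rule integral_abs_bound)
  also have "\<dots> \<le> expectation (\<lambda>\<omega>. 2 * ?C * indicator ?bad \<omega>)"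
  proof (rule integral_mono)
    show "integrable M (\<lambda>\<omega>. \<bar>?G \<omega> - ?F \<omega>\<bar>)" using intF intG by auto
    show "integrable M (\<lambda>\<omega>. 2 * ?C * indicator ?bad \<omega>)"
      using empty_cell_event(1)[OF m n] by (auto simp: emeasure_eq_measure)
    fix \<omega> assume \<omega>: "\<omega> \<in> space M"
    show "\<bar>?G \<omega> - ?F \<omega>\<bar> \<le> 2 * ?C * indicator ?bad \<omega>"
    proof (cases "\<omega> \<in> ?bad")
      case True
      then show ?thesis using F[OF \<omega>] G[OF \<omega>] by simp
    next
      case False
      then show ?thesis using MST_truncated_eq_outside[OF m \<omega> False] by simp
    qed
  qed
  also have "\<dots> = 2 * ?C * prob ?bad" using empty_cell_event(1)[OF m n] by simp
  finally show ?thesis by simp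
qed


lemma centred_MST_deviation:
  assumes m: "0 < m" and n: "1 \<le> n" and \<omega>: "\<omega> \<in> space M" "\<omega> \<notin> empty_cell_event m n"
    and G: "\<bar>MST (truncated h (4 * c\<^sub>2 / real m)) \<alpha> (\<lambda>i. X i \<omega>) n
        - expectation (\<lambda>\<omega>'. MST (truncated h (4 * c\<^sub>2 / real m)) \<alpha> (\<lambda>i. X i \<omega>') n)\<bar> < t"
  shows "\<bar>MST h \<alpha> (\<lambda>i. X i \<omega>) n - expectation (\<lambda>\<omega>'. MST h \<alpha> (\<lambda>i. X i \<omega>') n)\<bar>
    \<le> t + 2 * (real n)\<^sup>2 * (2 * c\<^sub>2) powr \<alpha> * prob (empty_cell_event m n)"
  using G expectation_truncated_diff[OF m n] MST_truncated_eq_outside[OF m \<omega>] by linarith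

text \<open>
  With the cut-off at level \<open>r n\<close>, the differences are bounded by \<open>B n\<close>, and \<open>t n\<close> is chosen so that
  \<open>(t n)\<^sup>2 / (n * (B n)\<^sup>2)\<close> is a multiple of \<open>n powr (1/4)\<close>, while \<open>t n\<close> is smaller than the normalisation
  by the factor \<open>n powr (- 1/8)\<close>.
\<close>
theorem MST_strong_law:
  "AE \<omega> in M. (\<lambda>n. 1 / real n powr (1 - \<alpha> / 2) *
    (MST h \<alpha> (\<lambda>i. X i \<omega>) n - expectation (\<lambda>\<omega>'. MST h \<alpha> (\<lambda>i. X i \<omega>') n))) \<longlonglongrightarrow> 0"
proof -
  obtain K where K: "0 < K" and conc: "\<forall>n\<ge>1. \<forall>r\<ge>0. \<forall>B>0. \<forall>t>0. K * r powr \<alpha> \<le> B \<longrightarrow>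
    prob {\<omega> \<in> space M. t \<le> \<bar>MST (truncated h r) \<alpha> (\<lambda>i. X i \<omega>) n
        - expectation (\<lambda>\<omega>'. MST (truncated h r) \<alpha> (\<lambda>i. X i \<omega>') n)\<bar>}
      \<le> 2 * exp (- t\<^sup>2 / (2 * real n * B\<^sup>2))"
    using truncated_MST_concentration by (elim exE conjE)
  \<comment> \<open>\<open>s * \<alpha> \<le> 1/4\<close> controls the differences, \<open>s \<le> 1/4\<close> keeps the exponent of \<open>m\<close> positive.\<close>
  define s where "s = min (1 / 4) (1 / (4 * \<alpha>))"
  have s: "0 < s" "s \<le> 1 / 4" "s * \<alpha> \<le> 1 / 4"
    using \<alpha> by (auto simp: s_def min_def field_simps)
  define m where "m n = nat \<lfloor>real n powr (1 / 2 - s)\<rfloor>" for n :: nat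
  define r where "r n = 4 * c\<^sub>2 / real (m n)" for n
  define C where "C = K * (8 * c\<^sub>2) powr \<alpha>"
  define B where "B n = C * real n powr (1 / 4 - \<alpha> / 2)" for n :: nat
  define t where "t n = real n powr (7 / 8 - \<alpha> / 2)" for n :: nat
  have C: "0 < C" using K c\<^sub>2 by (simp add: C_def)
  have m_bounds: "0 < m n" "real n powr (1 / 2 - s) / 2 \<le> real (m n)" "real (m n) \<le> real n powr (1 / 2 - s)"
    if "1 \<le> n" for n
  proof -
    define z where "z = real n powr (1 / 2 - s)"
    have "1 \<le> z" using that s ge_one_powr_ge_zero[of "real n" "1 / 2 - s"] by (simp add: z_def)
    moreover from this have "real (nat \<lfloor>z\<rfloor>) = of_int \<lfloor>z\<rfloor>" "1 \<le> \<lfloor>z\<rfloor>" by simp_all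
    ultimately show "0 < m n" "real n powr (1 / 2 - s) / 2 \<le> real (m n)" "real (m n) \<le> real n powr (1 / 2 - s)"
      unfolding m_def z_def[symmetric] by linarith+
  qed
  have bad: "prob (empty_cell_event (m n) n) \<le> real n * exp (- \<epsilon> * real n powr (2 * s))" if n: "1 \<le> n" for n
  proof -
    have sq: "(real (m n))\<^sup>2 \<le> real n powr (1 - 2 * s)"
    proof -
      have "(real (m n))\<^sup>2 \<le> (real n powr (1 / 2 - s))\<^sup>2"
        using m_bounds[OF n] by (intro power_mono) auto
      also have "\<dots> = real n powr (1 - 2 * s)"
        using n by (simp add: power2_eq_square flip: powr_add)
      finally show ?thesis .
    qed
    have "real n powr (1 - 2 * s) \<le> real n powr 1" using n s by (intro powr_mono) auto
    also have "\<dots> = real n" using n by simp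
    finally have sq_n: "(real (m n))\<^sup>2 \<le> real n" by (rule order_trans[OF sq])
    have "real n powr (2 * s) * (real (m n))\<^sup>2 \<le> real n powr (2 * s) * real n powr (1 - 2 * s)"
      using sq by (intro mult_left_mono) auto
    also have "\<dots> = real n" using n by (simp flip: powr_add)
    finally have "real n powr (2 * s) \<le> real n / (real (m n))\<^sup>2"
      using m_bounds(1)[OF n] by (simp add: field_simps)
    then have "\<epsilon> * real n powr (2 * s) \<le> \<epsilon> * (real n / (real (m n))\<^sup>2)" using \<epsilon> by (intro mult_left_mono) auto
    then have "exp (- \<epsilon> * real n / (real (m n))\<^sup>2) \<le> exp (- \<epsilon> * real n powr (2 * s))" by simp
    then have "(real (m n))\<^sup>2 * exp (- \<epsilon> * real n / (real (m n))\<^sup>2) \<le> real n * exp (- \<epsilon> * real n powr (2 * s))"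
      using sq_n by (intro mult_mono) auto
    with empty_cell_event(2)[OF m_bounds(1)[OF n] n] show ?thesis by linarith
  qed
  define dev where "dev n = {\<omega> \<in> space M. t n \<le> \<bar>MST (truncated h (r n)) \<alpha> (\<lambda>i. X i \<omega>) n
        - expectation (\<lambda>\<omega>'. MST (truncated h (r n)) \<alpha> (\<lambda>i. X i \<omega>') n)\<bar>}" for n
  have dev_prob: "prob (dev n) \<le> 2 * exp (- 1 / (2 * C\<^sup>2) * real n powr (1 / 4))" if n: "1 \<le> n" for n
  proof -
    have n0: "0 < real n" using n by simp
    have r0: "0 \<le> r n" using c\<^sub>2 by (simp add: r_def)
    have "r n \<le> 4 * c\<^sub>2 / (real n powr (1 / 2 - s) / 2)"
      unfolding r_def using m_bounds[OF n] c\<^sub>2 n0 by (intro divide_left_mono) auto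
    also have "\<dots> = 8 * c\<^sub>2 * real n powr (- (1 / 2 - s))"
      unfolding powr_minus by (simp add: field_simps)
    also have "- (1 / 2 - s) = s - 1 / 2" by simp
    finally have "r n powr \<alpha> \<le> (8 * c\<^sub>2 * real n powr (s - 1 / 2)) powr \<alpha>"
      using r0 \<alpha> by (intro powr_mono2) auto
    also have "\<dots> = (8 * c\<^sub>2) powr \<alpha> * real n powr ((s - 1 / 2) * \<alpha>)"
      by (simp only: powr_mult powr_powr)
    also have "real n powr ((s - 1 / 2) * \<alpha>) \<le> real n powr (1 / 4 - \<alpha> / 2)"
      using s n by (intro powr_mono) (auto simp: algebra_simps)
    finally have "K * r n powr \<alpha> \<le> B n"
      using K c\<^sub>2 by (simp add: B_def C_def mult.assoc)
    moreover have "0 < B n" "0 < t n" using n0 C by (simp_all add: B_def t_def)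
    ultimately have "prob (dev n) \<le> 2 * exp (- (t n)\<^sup>2 / (2 * real n * (B n)\<^sup>2))"
      unfolding dev_def by (intro conc[rule_format] n r0)
    also have "- (t n)\<^sup>2 / (2 * real n * (B n)\<^sup>2) = - 1 / (2 * C\<^sup>2) * real n powr (1 / 4)"
    proof -
      have "(t n)\<^sup>2 = real n powr (7 / 4 - \<alpha>)"
        using n0 by (simp add: t_def power2_eq_square flip: powr_add)
      also have "\<dots> = real n powr (1 / 4) * (real n powr 1 * real n powr (1 / 2 - \<alpha>))"
        by (simp only: powr_add[symmetric]) simp
      also have "real n powr (1 / 2 - \<alpha>) = (real n powr (1 / 4 - \<alpha> / 2))\<^sup>2"
        using n0 by (simp add: power2_eq_square flip: powr_add)
      finally have "(t n)\<^sup>2 = real n powr (1 / 4) * (real n * (real n powr (1 / 4 - \<alpha> / 2))\<^sup>2)"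
        using n0 by simp
      then show ?thesis using n0 C by (simp add: B_def power_mult_distrib field_simps)
    qed
    finally show ?thesis .
  qed
  define A where "A n = (if n = 0 then {} else empty_cell_event (m n) n \<union> dev n)" for n
  have dev_meas: "dev n \<in> events" for n
    unfolding dev_def using MST_random_measurable[OF truncated_measurable] by measurable
  have bad_meas: "empty_cell_event (m n) n \<in> events" if "1 \<le> n" for n
    using empty_cell_event(1) m_bounds(1) that by blast
  have A_meas: "A n \<in> events" for n
    unfolding A_def using dev_meas bad_meas by auto
  have A_prob: "prob (A n) \<le> real n * exp (- \<epsilon> * real n powr (2 * s))
      + 2 * exp (- 1 / (2 * C\<^sup>2) * real n powr (1 / 4))" for n
  proof (cases "n = 0")
    case False
    then have n: "1 \<le> n" by simp
    have "prob (A n) \<le> prob (empty_cell_event (m n) n) + prob (dev n)"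
      using False dev_meas bad_meas[OF n] by (simp add: A_def measure_Un_le)
    with bad[OF n] dev_prob[OF n] show ?thesis by linarith
  qed (simp add: A_def)
  have "summable (\<lambda>n. prob (A n))"
  proof (rule summable_comparison_test_bigo)
    show "summable (\<lambda>n. norm (1 / real n ^ 2))"
      using inverse_power_summable[of 2, where 'a = real] by (simp add: inverse_eq_divide)
    have "(\<lambda>n. prob (A n)) \<in> O(\<lambda>n. real n * exp (- \<epsilon> * real n powr (2 * s))
      + 2 * exp (- 1 / (2 * C\<^sup>2) * real n powr (1 / 4)))"
      using A_prob by (intro landau_o.bigI[of 1] always_eventually) (auto intro: order_trans)
    also have "(\<lambda>n. real n * exp (- \<epsilon> * real n powr (2 * s))
      + 2 * exp (- 1 / (2 * C\<^sup>2) * real n powr (1 / 4))) \<in> O(\<lambda>n. 1 / real n ^ 2)"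
    proof (rule sum_in_bigo)
      show "(\<lambda>n. real n * exp (- \<epsilon> * real n powr (2 * s))) \<in> O(\<lambda>n. 1 / real n ^ 2)"
        using \<epsilon> s(1) by real_asymp
      have "0 < 1 / (2 * C\<^sup>2)" using C by simp
      then show "(\<lambda>n. 2 * exp (- 1 / (2 * C\<^sup>2) * real n powr (1 / 4))) \<in> O(\<lambda>n. 1 / real n ^ 2)"
        unfolding minus_divide_left[symmetric] by real_asymp
    qed
    finally show "(\<lambda>n. prob (A n)) \<in> O(\<lambda>n. 1 / real n ^ 2)" .
  qed
  from borel_cantelli_AE1[OF A_meas _ this]
  have AE: "AE \<omega> in M. \<forall>\<^sub>F n in sequentially. \<omega> \<in> space M - A n"
    by (simp add: emeasure_eq_measure)
  define D where "D = 2 * (2 * c\<^sub>2) powr \<alpha>"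
  define err where "err n = real n powr (- 1 / 8) +
    D * (real n powr (2 + \<alpha> / 2) * exp (- \<epsilon> * real n powr (2 * s)))" for n :: nat
  have err: "err \<longlonglongrightarrow> 0"
  proof -
    have "(\<lambda>n. real n powr (2 + \<alpha> / 2) * exp (- \<epsilon> * real n powr (2 * s))) \<longlonglongrightarrow> 0"
      using \<epsilon> s(1) by real_asymp
    moreover have "(\<lambda>n. real n powr (- 1 / 8)) \<longlonglongrightarrow> 0" by real_asymp
    ultimately have "err \<longlonglongrightarrow> 0 + D * 0"
      unfolding err_def by (intro tendsto_intros)
    then show ?thesis by simp
  qed
  show ?thesis
    using AE
  proof eventually_elim
    case (elim \<omega>)
    let ?Y = "\<lambda>n. MST h \<alpha> (\<lambda>i. X i \<omega>) n - expectation (\<lambda>\<omega>'. MST h \<alpha> (\<lambda>i. X i \<omega>') n)"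
    show ?case
    proof (rule Lim_null_comparison[OF _ err])
      show "\<forall>\<^sub>F n in sequentially. norm (1 / real n powr (1 - \<alpha> / 2) * ?Y n) \<le> err n"
        using elim eventually_ge_at_top[of 1]
      proof eventually_elim
        case (elim n)
        then have n: "1 \<le> n" and \<omega>: "\<omega> \<in> space M" "\<omega> \<notin> empty_cell_event (m n) n" "\<omega> \<notin> dev n"
          by (auto simp: A_def)
        have n0: "0 < real n" using n by simp
        have "\<bar>?Y n\<bar> \<le> t n + 2 * (real n)\<^sup>2 * (2 * c\<^sub>2) powr \<alpha> * prob (empty_cell_event (m n) n)"
          using \<omega> by (intro centred_MST_deviation m_bounds n) (auto simp: dev_def r_def)
        also have "\<dots> \<le> t n + 2 * (real n)\<^sup>2 * (2 * c\<^sub>2) powr \<alpha> * (real n * exp (- \<epsilon> * real n powr (2 * s)))"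
          using bad[OF n] by (intro add_left_mono mult_left_mono) auto
        finally have Y: "\<bar>?Y n\<bar> \<le> t n + D * (real n ^ 3 * exp (- \<epsilon> * real n powr (2 * s)))"
          by (simp add: D_def power2_eq_square power3_eq_cube algebra_simps)
        have "norm (1 / real n powr (1 - \<alpha> / 2) * ?Y n) = real n powr (\<alpha> / 2 - 1) * \<bar>?Y n\<bar>"
          using n0 by (simp add: abs_mult powr_diff)
        also have "\<dots> \<le> real n powr (\<alpha> / 2 - 1) * (t n + D * (real n ^ 3 * exp (- \<epsilon> * real n powr (2 * s))))"
          using Y by (intro mult_left_mono) auto
        also have "\<dots> = real n powr (\<alpha> / 2 - 1) * t n +
            D * (real n powr (\<alpha> / 2 - 1) * real n ^ 3 * exp (- \<epsilon> * real n powr (2 * s)))"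
          by (simp add: algebra_simps)
        also have "real n powr (\<alpha> / 2 - 1) * t n = real n powr (- 1 / 8)"
          by (simp add: t_def flip: powr_add)
        also have "real n powr (\<alpha> / 2 - 1) * real n ^ 3 = real n powr (2 + \<alpha> / 2)"
          using n0 powr_add[of "real n" "\<alpha> / 2 - 1" 3] by (simp add: powr_numeral add.commute)
        finally show ?case by (simp add: err_def)
      qed
    qed
  qed
qed

end

theorem theorem9:
  fixes M :: "'a measure"
    and X :: "nat \<Rightarrow> 'a \<Rightarrow> real^2"
    and f :: "real^2 \<Rightarrow> real"
    and h :: "real^2 \<Rightarrow> real^2 \<Rightarrow> real"
    and \<epsilon>\<^sub>1 \<epsilon>\<^sub>2 c\<^sub>1 c\<^sub>2 \<alpha> :: real
  assumes "prob_space M"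
    and "0 < \<epsilon>\<^sub>1" and "\<epsilon>\<^sub>1 \<le> \<epsilon>\<^sub>2"
    and "\<And>x. x \<in> unit_square \<Longrightarrow> \<epsilon>\<^sub>1 \<le> f x \<and> f x \<le> \<epsilon>\<^sub>2"
    and "\<And>i. i \<ge> 1 \<Longrightarrow>
      distributed M (restrict_space lborel unit_square) (X i) (\<lambda>x. ennreal (f x))"
    and "prob_space.indep_vars M (\<lambda>_. restrict_space borel unit_square) X {1..}"
    and "0 < c\<^sub>1" and "0 < c\<^sub>2"
    and "(\<lambda>(x, y). h x y) \<in> borel_measurable (restrict_space borel (unit_square \<times> unit_square))"
    and "\<And>x y. x \<in> unit_square \<Longrightarrow> y \<in> unit_square \<Longrightarrow>
      0 \<le> h x y \<and> h x y = h y x \<and> c\<^sub>1 * dist x y \<le> h x y \<and> h x y \<le> c\<^sub>2 * dist x y"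
    and "0 < \<alpha>"
  shows "AE \<omega> in M.
    (\<lambda>n. 1 / real n powr (1 - \<alpha> / 2) *
      (MST h \<alpha> (\<lambda>i. X i \<omega>) n - prob_space.expectation M (\<lambda>\<omega>'. MST h \<alpha> (\<lambda>i. X i \<omega>') n)))
    \<longlonglongrightarrow> 0"
proof -
  interpret prob_space M by fact
  interpret distance_like unit_square h c\<^sub>1 c\<^sub>2 \<alpha>
    using assms by unfold_locales blast+
  interpret random_points M h c\<^sub>1 c\<^sub>2 \<alpha> X f \<epsilon>\<^sub>1
    using assms by unfold_locales blast+
  show ?thesis by (rule MST_strong_law)
qed

end
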